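(* Let $p\ge 1$ be an integer, let $\boldsymbol{\delta}\in\mathbb{R}^p$, and let $\Sigma$ be a (symmetric) positive definite $p\times p$ real matrix. Let $(Z_i^{(n)})_{n\ge 1,\,1\le i\le n}$ be a triangular array of $\mathbb{R}^p$-valued random vectors such that for all $n$ and all $i\in\{1,\dots,n\}$, $$\mathbb{E}[Z_i^{(n)}]=\frac{\boldsymbol{\delta}}{\sqrt{n}},\qquad \mathrm{Cov}[Z_i^{(n)}]=\Sigma,$$ and such that the random vectors $W_i^{(n)}=Z_i^{(n)}-\frac{\boldsymbol{\delta}}{\sqrt n}$ ($n\ge 1$, $1\le i\le n$) are independent and identically distributed. (The null hypothesis is the case $\boldsymbol{\delta}=0$; general $\boldsymbol{\delta}$ gives a sequence of local alternatives.) For $n\ge 2$ let $\xi_{\mathrm{sc},n}$ be the score test statistic of conditional logistic regression for the null hypothesis $\boldsymbol{\beta}=0$ and $\xi_{\mathrm{hot},n}$ the paired Hotelling test statistic, both computed from the pair differences $Z_1^{(n)},\dots,Z_n^{(n)}$. Then the two tests are asymptotically equivalent, i.e. $\xi_{\mathrm{sc},n}-\xi_{\mathrm{hot},n}\to 0$ in probability as $n\to\infty$. More precisely, as $n\to\infty$, $$n\left(\xi_{\mathrm{sc},n}-\xi_{\mathrm{hot},n}\right)\xrightarrow{d}K,$$ where $\xrightarrow{d}$ denotes convergence in distribution and $$K=(\boldsymbol{\delta}+V)^\top\Sigma^{-1}\left(\Sigma-(\boldsymbol{\delta}+V)(\boldsymbol{\delta}+V)^\top\right)\Sigma^{-1}(\boldsymbol{\delta}+V),\qquad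 V\sim\mathcal{N}(0,\Sigma).$$
   Context: Setting: there are $n$ matched pairs, each consisting of one case (label $1$) with predictor $X_{i1}\in\mathbb{R}^p$ and one control (label $0$) with predictor $X_{i2}\in\mathbb{R}^p$; both tests depend only on the differences $Z_i=X_{i1}-X_{i2}$. Vectors are column vectors, $^\top$ denotes transposition, and $\mathcal{N}(0,\Sigma)$ is the centered Gaussian distribution on $\mathbb{R}^p$ with covariance $\Sigma$. Given $Z_1,\dots,Z_n\in\mathbb{R}^p$ with $n\ge 2$, put $\bar Z=\frac1n\sum_{i=1}^n Z_i$. Paired Hotelling statistic: with the unbiased sample covariance $C=\frac{1}{n-1}\sum_{i=1}^n (Z_i-\bar Z)(Z_i-\bar Z)^\top$, $$\xi_{\mathrm{hot}}=n\,\bar Z^\top C^{-1}\bar Z.$$ Score statistic of conditional logistic regression: the conditional log-likelihood is $L(\boldsymbol{\beta},Z)=-\sum_{i=1}^n\log(1+e^{-\boldsymbol{\beta}^\top Z_i})$ for $\boldsymbol{\beta}\in\mathbb{R}^p$, the score is $s(\boldsymbol{\beta},Z)=\frac{\partial L}{\partial\boldsymbol{\beta}}(\boldsymbol{\beta},Z)$, and the information matrix is $\mathcal{I}(\boldsymbol{\beta},Z)=\sum_{i=1}^n \frac{e^{\boldsymbol{\beta}^\top Z_i}}{(1+e^{\boldsymbol{\beta}^\top Z_i})^2}Z_iZ_i^\top$. The score statistic for $\boldsymbol{\beta}=0$ is $s(0,Z)^\top\mathcal{I}(0,Z)^{-1}s(0,Z)$; since $s(0,Z)=\frac n2\bar Z$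 and $\mathcal{I}(0,Z)=\frac14\sum_{i=1}^n Z_iZ_i^\top$, it equals $$\xi_{\mathrm{sc}}=n\,\bar Z^\top\left(\frac1n\sum_{i=1}^n Z_iZ_i^\top\right)^{-1}\bar Z.$$ The statistics $\xi_{\mathrm{hot},n}$ and $\xi_{\mathrm{sc},n}$ are these quantities with $Z_i=Z_i^{(n)}$. Convention: on the event that a matrix to be inverted is singular, the corresponding statistic is set to $0$. *)

theory Defs
  imports "HOL-Probability.Probability"
begin

definition outer :: "real ^ 'p \<Rightarrow> real ^ 'p \<Rightarrow> real ^ 'p ^ 'p" where
  "outer x y = (\<chi> j k. x $ j * y $ k)"

definition pos_definite :: "real ^ 'p ^ 'p \<Rightarrow> bool" where
  "pos_definite A \<longleftrightarrow> transpose A = A \<and> (\<forall>x. x \<noteq> 0 \<longrightarrow> 0 < x \<bullet> (A *v x))"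

text \<open>The form $x^\top A^{-1} x$. Since \<^const>\<open>matrix_inv\<close> is unspecified on singular
  matrices, the convention that a statistic is $0$ in that case is built in here.\<close>

definition inv_quad_form :: "real ^ 'p ^ 'p \<Rightarrow> real ^ 'p \<Rightarrow> real" where
  "inv_quad_form A x = (if invertible A then x \<bullet> (matrix_inv A *v x) else 0)"

definition sample_mean :: "nat \<Rightarrow> (nat \<Rightarrow> real ^ 'p) \<Rightarrow> real ^ 'p" where
  "sample_mean n Z = (\<Sum>i\<in>{1..n}. Z i) /\<^sub>R real n"

definition sample_cov :: "nat \<Rightarrow> (nat \<Rightarrow> real ^ 'p) \<Rightarrow> real ^ 'p ^ 'p" where
  "sample_cov n Z =
     (\<Sum>i\<in>{1..n}. outer (Z i - sample_mean n Z) (Z i - sample_mean n Z)) /\<^sub>R (real n - 1)"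

definition hotelling_stat :: "nat \<Rightarrow> (nat \<Rightarrow> real ^ 'p) \<Rightarrow> real" where
  "hotelling_stat n Z = real n * inv_quad_form (sample_cov n Z) (sample_mean n Z)"

definition cond_loglik :: "nat \<Rightarrow> (nat \<Rightarrow> real ^ 'p) \<Rightarrow> real ^ 'p \<Rightarrow> real" where
  "cond_loglik n Z \<beta> = - (\<Sum>i\<in>{1..n}. ln (1 + exp (- (\<beta> \<bullet> Z i))))"

definition score :: "nat \<Rightarrow> (nat \<Rightarrow> real ^ 'p) \<Rightarrow> real ^ 'p \<Rightarrow> real ^ 'p" where
  "score n Z \<beta> = (THE g. GDERIV (cond_loglik n Z) \<beta> :> g)"

definition information :: "nat \<Rightarrow> (nat \<Rightarrow> real ^ 'p) \<Rightarrow> real ^ 'p \<Rightarrow> real ^ 'p ^ 'p" where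
  "information n Z \<beta> =
     (\<Sum>i\<in>{1..n}. (exp (\<beta> \<bullet> Z i) / (1 + exp (\<beta> \<bullet> Z i))\<^sup>2) *\<^sub>R outer (Z i) (Z i))"

definition score_stat :: "nat \<Rightarrow> (nat \<Rightarrow> real ^ 'p) \<Rightarrow> real" where
  "score_stat n Z = inv_quad_form (information n Z 0) (score n Z 0)"

lemma GDERIV_cond_loglik:
  "GDERIV (cond_loglik n Z) \<beta> :> (\<Sum>i\<in>{1..n}. (1 / (1 + exp (\<beta> \<bullet> Z i))) *\<^sub>R Z i)"
proof -
  have pos: "0 < 1 + exp (x::real)" for x
    by (simp add: add_pos_pos)
  have frac: "exp (- x) / (1 + exp (- x)) = 1 / (1 + exp x)" for x :: real
    using pos[of x] pos[of "- x"] by (simp add: exp_minus field_simps)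
  have "((\<lambda>b. - (\<Sum>i\<in>{1..n}. ln (1 + exp (- (b \<bullet> Z i))))) has_derivative
      (\<lambda>h. - (\<Sum>i\<in>{1..n}. (- (h \<bullet> Z i)) * (exp (- (\<beta> \<bullet> Z i)) / (1 + exp (- (\<beta> \<bullet> Z i)))))))
      (at \<beta>)"
    by (rule derivative_eq_intros refl pos)+ (simp add: field_simps)
  then show ?thesis
    unfolding gderiv_def cond_loglik_def [abs_def]
    by (rule has_derivative_eq_rhs) (simp add: frac inner_sum_right sum_negf)
qed

lemma score_eq:
  fixes Z :: "nat \<Rightarrow> real ^ 'p"
  shows "score n Z \<beta> = (\<Sum>i\<in>{1..n}. (1 / (1 + exp (\<beta> \<bullet> Z i))) *\<^sub>R Z i)"
proof -
  have "g = g'" if "GDERIV f \<beta> :> g" "GDERIV f \<beta> :> g'" for f and g g' :: "real ^ 'p"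
  proof -
    have "(\<lambda>h. h \<bullet> g) = (\<lambda>h. h \<bullet> g')"
      using that unfolding gderiv_def by (rule has_derivative_unique)
    then show ?thesis
      by (metis vector_eq_ldot)
  qed
  from this [OF _ GDERIV_cond_loglik] show ?thesis
    unfolding score_def by (intro the_equality GDERIV_cond_loglik)
qed

lemma score_0: "score n Z 0 = (real n / 2) *\<^sub>R sample_mean n Z"
  by (cases "n = 0") (simp_all add: score_eq sample_mean_def scaleR_sum_right)

lemma information_0: "information n Z 0 = (1 / 4) *\<^sub>R (\<Sum>i\<in>{1..n}. outer (Z i) (Z i))"
  by (simp add: information_def scaleR_sum_right)

definition covariance_matrix :: "'a measure \<Rightarrow> ('a \<Rightarrow> real ^ 'p) \<Rightarrow> real ^ 'p ^ 'p" where
  "covariance_matrix M X =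
     integral\<^sup>L M (\<lambda>\<omega>. outer (X \<omega> - integral\<^sup>L M X) (X \<omega> - integral\<^sup>L M X))"

text \<open>$\mathcal{N}(0,\Sigma)$ given by its Lebesgue density; meant for positive definite \<open>\<Sigma>\<close> only.\<close>

definition gaussian :: "real ^ 'p ^ 'p \<Rightarrow> (real ^ 'p) measure" where
  "gaussian \<Sigma> = density lborel (\<lambda>x.
     ennreal (exp (- (x \<bullet> (matrix_inv \<Sigma> *v x)) / 2) / sqrt ((2 * pi) ^ CARD('p) * det \<Sigma>)))"

definition limit_K :: "real ^ 'p ^ 'p \<Rightarrow> real ^ 'p \<Rightarrow> real ^ 'p \<Rightarrow> real" where
  "limit_K \<Sigma> \<delta> v = (let u = \<delta> + v in
     u \<bullet> (matrix_inv \<Sigma> *v ((\<Sigma> - outer u u) *v (matrix_inv \<Sigma> *v u))))"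

end

theory Submission
  imports Defs
begin

text \<open>Write $u = \sqrt n\,\bar Z$, $A = \frac1n\sum_i (Z_i-\bar Z)(Z_i-\bar Z)^\top$ and
$q = u^\top A^{-1} u$. The sample covariance is $\frac{n}{n-1}A$, and the information matrix at $0$
is $\frac n4 (A + \frac1n u u^\top)$, a rank-one update of $A$. By the Sherman--Morrison formula both
statistics are functions of the single number $q$: Hotelling's is $(1-\frac1n)q$, the score
statistic is $q/(1+\frac qn)$. Hence
\[ n(\xi_{sc}-\xi_{hot}) = \frac{q\,(1-(1-\frac1n)q)}{1+\frac qn} \]
(\<open>scaled_statistic_difference\<close>), which is close to $q-q^2$, while the limit variable is
$K = Q-Q^2$ with $Q = (\delta+V)^\top\Sigma^{-1}(\delta+V)$ (\<open>limit_K_eq\<close>).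

It remains to pass from $q$ to $Q$. In terms of the centred vectors $W_i$ one has
$A = \frac1n\sum_i W_iW_i^\top - \frac1n(u-\delta)(u-\delta)^\top$ and $u=\delta+n^{-1/2}\sum_i W_i$.
The Gram matrix tends to $\Sigma$ in probability by a weak law of large numbers; its summands are
merely integrable, so the law is proved by truncation (\<open>weak_law_identical_rows\<close>). The vectors $u$
have bounded second moments, so up to small probability they stay in a compact ball, and the tube
lemma turns continuity of the explicit formula at the points $(0,\Sigma,x)$ into closeness of
$n(\xi_{sc}-\xi_{hot})$ to $Q_n-Q_n^2$, $Q_n=u^\top\Sigma^{-1}u$, with high probability
(\<open>eventually_nbhd_with_high_probability\<close>, \<open>eventually_statistic_difference_close\<close>).
The same closeness after division by $n$ gives convergence to $0$ in probability.

The convergence of $Q_n$ to $Q$ in law is reduced to the one-dimensional central limit theorem.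
Since $e^{-k\,x^\top\Sigma^{-1}x}$ is the expectation of $e^{i\sqrt{2k}\,Y\cdot x}$ for
$Y\sim\mathcal N(0,\Sigma^{-1})$, the Laplace transform of $Q_n$ is an average of characteristic
functions of the linear forms $t\cdot u$, which converge by the central limit theorem
(\<open>laplace_transform_quadratic_form_tendsto\<close>). At integer arguments the Laplace transforms are the
moments of $e^{-Q_n}\in[0,1]$, so Weierstrass approximation yields convergence of
$\mathbb E\,g(e^{-Q_n})$ for every $g$ continuous on $[0,1]$. The piecewise linear step functions that
determine weak convergence, composed with $q\mapsto q-q^2$, are of this form, because
$q-q^2\to-\infty$ as $e^{-q}\to 0$ (\<open>continuous_on_cts_step_of_log\<close>).

The one fact needed about the Gaussian density is its characteristic function. It comes from a
factorization $\Sigma = PP^\top$ and the determinant rule for Lebesgue measure under linear maps.\<close>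

section \<open>Quadratic forms in the inverse of a matrix\<close>

lemma
  fixes A :: "'b::semiring_1 ^ 'n ^ 'm"
  assumes "invertible A"
  shows matrix_inv_right: "A ** matrix_inv A = mat 1" and matrix_inv_left: "matrix_inv A ** A = mat 1"
  using someI_ex[OF assms[unfolded invertible_def]] by (auto simp: matrix_inv_def)

lemma inv_quad_form_eqI:
  assumes "invertible A" "A *v y = x"
  shows "inv_quad_form A x = x \<bullet> y"
proof -
  have "matrix_inv A *v x = y"
    using assms(2)[symmetric] matrix_inv_left[OF assms(1)]
    by (simp add: matrix_vector_mul_assoc)
  then show ?thesis using assms(1) by (simp add: inv_quad_form_def)
qed

lemma matrix_inv_solves: "invertible A \<Longrightarrow> A *v (matrix_inv A *v x) = (x :: real ^ 'p)"
  by (simp add: matrix_vector_mul_assoc matrix_inv_right)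

lemma invertible_iff_kernel:
  fixes A :: "real ^ 'p ^ 'p"
  shows "invertible A \<longleftrightarrow> (\<forall>x. A *v x = 0 \<longrightarrow> x = 0)"
  by (simp add: invertible_left_inverse matrix_left_invertible_ker)

lemma inv_quad_form_scale:
  fixes A :: "real ^ 'p ^ 'p"
  assumes "c \<noteq> 0"
  shows "inv_quad_form (c *\<^sub>R A) (d *\<^sub>R x) = d\<^sup>2 / c * inv_quad_form A x"
proof -
  have inv: "invertible (c *\<^sub>R A) \<longleftrightarrow> invertible A"
    using assms by (simp add: invertible_iff_kernel scaleR_matrix_vector_assoc[symmetric])
  show ?thesis
  proof (cases "invertible A")
    case True
    have "(c *\<^sub>R A) *v ((d / c) *\<^sub>R (matrix_inv A *v x)) = d *\<^sub>R x"
      using assms by (simp add: scaleR_matrix_vector_assoc[symmetric] matrix_vector_mult_scaleR matrix_inv_solves[OF True])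
    with True inv have "inv_quad_form (c *\<^sub>R A) (d *\<^sub>R x) = (d *\<^sub>R x) \<bullet> ((d / c) *\<^sub>R (matrix_inv A *v x))"
      by (intro inv_quad_form_eqI) auto
    then show ?thesis using True by (simp add: inv_quad_form_def power2_eq_square)
  next
    case False then show ?thesis using inv by (simp add: inv_quad_form_def)
  qed
qed

lemma outer_mult_vector: "outer x y *v z = (y \<bullet> z) *\<^sub>R x"
  by (simp add: vec_eq_iff outer_def matrix_vector_mult_def inner_vec_def sum_distrib_right mult_ac
      sum_distrib_left)

lemma outer_scaleR: "outer (c *\<^sub>R x) (c *\<^sub>R y) = c\<^sup>2 *\<^sub>R outer x y"
  by (simp add: vec_eq_iff outer_def power2_eq_square)

text \<open>The Sherman--Morrison formula evaluated on the direction of the update: if $Ay=x$ then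
$(A+s\,xx^\top)y=(1+s\,x\cdot y)x$, so the updated matrix is again solved by a multiple of $y$.\<close>
lemma inv_quad_form_rank_one_update:
  fixes A :: "real ^ 'p ^ 'p"
  assumes inv: "invertible A" and nz: "1 + s * inv_quad_form A x \<noteq> 0"
  shows "inv_quad_form (A + s *\<^sub>R outer x x) x
      = inv_quad_form A x / (1 + s * inv_quad_form A x)"
proof -
  define q where "q = inv_quad_form A x"
  define y where "y = matrix_inv A *v x"
  have q: "q = x \<bullet> y" using inv by (simp add: q_def y_def inv_quad_form_def)
  have y: "A *v y = x" by (simp add: y_def matrix_inv_solves inv)
  have mv: "(A + s *\<^sub>R outer x x) *v z = A *v z + (s * (x \<bullet> z)) *\<^sub>R x" for z
    by (simp add: matrix_vector_mult_add_rdistrib scaleR_matrix_vector_assoc[symmetric] outer_mult_vector)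
  have "invertible (A + s *\<^sub>R outer x x)"
    unfolding invertible_iff_kernel
  proof (intro allI impI)
    fix z assume "(A + s *\<^sub>R outer x x) *v z = 0"
    then have "A *v (z + (s * (x \<bullet> z)) *\<^sub>R y) = 0"
      by (simp add: mv matrix_vector_right_distrib matrix_vector_mult_scaleR y)
    then have z: "z + (s * (x \<bullet> z)) *\<^sub>R y = 0" using inv invertible_iff_kernel by blast
    then have "x \<bullet> z + (s * (x \<bullet> z)) * q = 0"
      by (metis inner_add_right inner_scaleR_right inner_zero_right q)
    then have "(x \<bullet> z) * (1 + s * q) = 0" by (simp add: algebra_simps)
    then have "x \<bullet> z = 0" using nz by (simp add: q_def)
    then show "z = 0" using z by simp
  qed
  moreover have "(A + s *\<^sub>R outer x x) *v ((1 / (1 + s * q)) *\<^sub>R y) = x"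
  proof -
    have "(A + s *\<^sub>R outer x x) *v ((1 / (1 + s * q)) *\<^sub>R y) = (1 / (1 + s * q)) *\<^sub>R ((1 + s * q) *\<^sub>R x)"
      unfolding matrix_vector_mult_scaleR mv y q[symmetric] by (simp add: scaleR_add_left)
    then show ?thesis using nz by (simp add: q_def)
  qed
  ultimately show ?thesis
    by (subst inv_quad_form_eqI) (auto simp: q[symmetric] q_def[symmetric])
qed

text \<open>Cramer's rule presents the quadratic form as a rational function of the entries of $A$ and $x$,
which gives its measurability and continuity. For singular $A$ division by $\det A = 0$
yields $0$, which is exactly the convention for the statistics, so no case distinction is left.\<close>
lemma inv_quad_form_cramer:
  fixes A :: "real ^ 'p ^ 'p"
  shows "inv_quad_form A x
    = (\<Sum>k\<in>UNIV. x $ k * det (\<chi> i j. if j = k then x $ i else A $ i $ j)) / det A"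
proof (cases "invertible A")
  case True
  then have "det A \<noteq> 0" by (simp add: invertible_det_nz)
  from cramer[OF this] have "A *v (\<chi> k. det (\<chi> i j. if j = k then x $ i else A $ i $ j) / det A) = x"
    by blast
  from inv_quad_form_eqI[OF True this] show ?thesis
    by (simp add: inner_vec_def sum_divide_distrib)
next
  case False
  then show ?thesis by (simp add: inv_quad_form_def invertible_det_nz)
qed

lemma tendsto_det:
  fixes A :: "real ^ 'p ^ 'p" and f :: "'z \<Rightarrow> real ^ 'p ^ 'p"
  assumes "\<And>i j. ((\<lambda>z. f z $ i $ j) \<longlongrightarrow> A $ i $ j) F"
  shows "((\<lambda>z. det (f z)) \<longlongrightarrow> det A) F"
  unfolding det_def by (intro tendsto_intros assms)

lemma tendsto_inv_quad_form:
  fixes A :: "real ^ 'p ^ 'p"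
  assumes f: "(f \<longlongrightarrow> A) F" and g: "(g \<longlongrightarrow> x) F" and "invertible A"
  shows "((\<lambda>z. inv_quad_form (f z) (g z)) \<longlongrightarrow> inv_quad_form A x) F"
proof -
  have [tendsto_intros]: "((\<lambda>z. f z $ i $ j) \<longlongrightarrow> A $ i $ j) F" "((\<lambda>z. g z $ i) \<longlongrightarrow> x $ i) F" for i j
    by (intro tendsto_vec_nth f g)+
  have "det A \<noteq> 0" using assms(3) by (simp add: invertible_det_nz)
  then show ?thesis unfolding inv_quad_form_cramer
    by (intro tendsto_intros tendsto_det) (auto intro: tendsto_intros)
qed

lemma borel_measurable_det:
  fixes f :: "'z \<Rightarrow> real ^ 'p ^ 'p"
  assumes "\<And>i j. (\<lambda>z. f z $ i $ j) \<in> borel_measurable N"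
  shows "(\<lambda>z. det (f z)) \<in> borel_measurable N"
  unfolding det_def by (intro borel_measurable_sum borel_measurable_times borel_measurable_prod assms) simp

lemma borel_measurable_inv_quad_form:
  fixes f :: "'z \<Rightarrow> real ^ 'p ^ 'p"
  assumes f: "\<And>i j. (\<lambda>z. f z $ i $ j) \<in> borel_measurable N" and g: "\<And>i. (\<lambda>z. g z $ i) \<in> borel_measurable N"
  shows "(\<lambda>z. inv_quad_form (f z) (g z)) \<in> borel_measurable N"
proof -
  have "(\<lambda>z. if j = k then g z $ i else f z $ i $ j) \<in> borel_measurable N" for i j k
    by (cases "j = k") (simp_all add: f g)
  then show ?thesis unfolding inv_quad_form_cramer
    by (intro borel_measurable_sum borel_measurable_times borel_measurable_divide borel_measurable_det f g)
      simp
qed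

lemma pos_definite_invertible: "pos_definite A \<Longrightarrow> invertible A"
  unfolding pos_definite_def invertible_iff_kernel by fastforce

lemma matrix_inv_eqI:
  fixes A :: "real ^ 'p ^ 'p"
  assumes "A ** B = mat 1"
  shows "matrix_inv A = B"
proof -
  have "invertible A" using assms by (auto simp: invertible_right_inverse)
  then have "matrix_inv A ** A = mat 1" by (rule matrix_inv_left)
  then have "(matrix_inv A ** A) ** B = B" by simp
  then show ?thesis by (simp add: matrix_mul_assoc[symmetric] assms)
qed

lemma inner_matrix_transpose:
  fixes A :: "real ^ 'p ^ 'p"
  shows "(A *v x) \<bullet> y = x \<bullet> (transpose A *v y)"
  unfolding transpose_matrix_vector inner_commute[of x] dot_lmul_matrix by (rule inner_commute)

lemma pos_definite_matrix_inv:
  fixes A :: "real ^ 'p ^ 'p"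
  assumes "pos_definite A"
  shows "pos_definite (matrix_inv A)"
proof -
  have inv: "invertible A" by (rule pos_definite_invertible[OF assms])
  have sym: "transpose A = A" using assms by (simp add: pos_definite_def)
  have "A ** transpose (matrix_inv A) = mat 1"
    using matrix_transpose_mul[of "matrix_inv A" A] by (simp add: matrix_inv_left[OF inv] sym transpose_mat)
  from matrix_inv_eqI[OF this] have "transpose (matrix_inv A) = matrix_inv A" by simp
  moreover have "0 < x \<bullet> (matrix_inv A *v x)" if "x \<noteq> 0" for x
  proof -
    define y where "y = matrix_inv A *v x"
    have x: "x = A *v y" by (simp add: y_def matrix_inv_solves inv)
    with that have "y \<noteq> 0" by auto
    then have "0 < y \<bullet> (A *v y)" using assms by (simp add: pos_definite_def)
    then have "0 < x \<bullet> y" by (simp only: x[symmetric] inner_commute)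
    then show ?thesis unfolding y_def .
  qed
  ultimately show ?thesis by (simp add: pos_definite_def)
qed

lemma matrix_inv_matrix_inv:
  fixes A :: "real ^ 'p ^ 'p"
  assumes "invertible A"
  shows "matrix_inv (matrix_inv A) = A"
  by (intro matrix_inv_eqI matrix_inv_left assms)

lemma inner_symmetric_matrix:
  fixes A :: "real ^ 'p ^ 'p"
  assumes "transpose A = A"
  shows "x \<bullet> (A *v y) = y \<bullet> (A *v x)"
  using inner_matrix_transpose[of A x y] by (simp add: assms inner_commute)

text \<open>Gram--Schmidt for the inner product $x^\top A y$: as long as fewer than $p$ vectors have been chosen,
their images under $A$ do not span the space, and any nonzero vector orthogonal to those
images can be normalised and added.\<close>
lemma pos_definite_orthonormal_family:
  fixes A :: "real ^ 'p ^ 'p"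
  assumes A: "pos_definite A" and "k \<le> CARD('p)"
  shows "\<exists>S. finite S \<and> card S = k \<and> (\<forall>x\<in>S. \<forall>y\<in>S. x \<bullet> (A *v y) = (if x = y then 1 else 0))"
  using assms(2)
proof (induction k)
  case 0
  then show ?case by (intro exI[of _ "{}"]) auto
next
  case (Suc k)
  then obtain S where S: "finite S" "card S = k"
    and on: "\<And>x y. x \<in> S \<Longrightarrow> y \<in> S \<Longrightarrow> x \<bullet> (A *v y) = (if x = y then 1 else 0)" by auto
  have "dim ((*v) A ` S) \<le> card ((*v) A ` S)" using S by (intro dim_le_card') auto
  also have "\<dots> \<le> k" using S card_image_le by blast
  also have "\<dots> < DIM(real ^ 'p)" using Suc.prems by simp
  finally have dim: "dim ((*v) A ` S) < DIM(real ^ 'p)" .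
  obtain x where x: "x \<noteq> 0" "\<And>y. y \<in> (*v) A ` S \<Longrightarrow> orthogonal x y"
    using orthogonal_to_subspace_exists[OF dim] by (metis span_base)
  define c where "c = x \<bullet> (A *v x)"
  have c: "0 < c" using A x(1) by (simp add: c_def pos_definite_def)
  define z where "z = (1 / sqrt c) *\<^sub>R x"
  have zz: "z \<bullet> (A *v z) = 1"
    using c by (simp add: z_def matrix_vector_mult_scaleR c_def[symmetric] divide_simps)
  have zy: "z \<bullet> (A *v y) = 0" "y \<bullet> (A *v z) = 0" if "y \<in> S" for y
  proof -
    show *: "z \<bullet> (A *v y) = 0" using x(2)[of "A *v y"] that
      by (auto simp: z_def orthogonal_def)
    show "y \<bullet> (A *v z) = 0" using A * inner_symmetric_matrix[of A y z] by (simp add: pos_definite_def)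
  qed
  have ne: "z \<noteq> y" "y \<noteq> z" if "y \<in> S" for y using zz zy(1)[OF that] by auto
  show ?case
  proof (intro exI[of _ "insert z S"] conjI)
    show "card (insert z S) = Suc k" using S ne by (subst card_insert_disjoint) auto
    show "\<forall>x\<in>insert z S. \<forall>y\<in>insert z S. x \<bullet> (A *v y) = (if x = y then 1 else 0)"
    proof (intro ballI)
      fix x y assume "x \<in> insert z S" "y \<in> insert z S"
      then consider "x = z" "y = z" | "x = z" "y \<in> S" | "x \<in> S" "y = z" | "x \<in> S" "y \<in> S" by blast
      then show "x \<bullet> (A *v y) = (if x = y then 1 else 0)"
        using zz zy ne on by cases (simp_all only: if_True if_False refl simp_thms)
    qed
  qed (use S in simp)
qed

text \<open>The columns of $P$ are an orthonormal basis for the inner product $x^\top\Sigma^{-1}y$, that is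
$P^\top\Sigma^{-1}P=1$.\<close>
lemma pos_definite_factorization:
  fixes \<Sigma> :: "real ^ 'p ^ 'p"
  assumes "pos_definite \<Sigma>"
  obtains P :: "real ^ 'p ^ 'p" where "P ** transpose P = \<Sigma>" "invertible P" "\<And>y. (P *v y) \<bullet> (matrix_inv \<Sigma> *v (P *v y)) = y \<bullet> y"
proof -
  let ?A = "matrix_inv \<Sigma>"
  have inv: "invertible \<Sigma>" by (rule pos_definite_invertible[OF assms])
  obtain S where S: "finite S" "card S = CARD('p)"
    and on: "\<And>x y. x \<in> S \<Longrightarrow> y \<in> S \<Longrightarrow> x \<bullet> (?A *v y) = (if x = y then 1 else 0)"
    using pos_definite_orthonormal_family[OF pos_definite_matrix_inv[OF assms], of "CARD('p)"] by blast
  obtain b where b: "bij_betw b (UNIV :: 'p set) S"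
    using S by (metis finite_class.finite_UNIV finite_same_card_bij)
  define P :: "real ^ 'p ^ 'p" where "P = (\<chi> i j. b j $ i)"
  have PAP: "transpose P ** (?A ** P) = mat 1"
  proof -
    have "(transpose P ** (?A ** P)) $ i $ j = b i \<bullet> (?A *v b j)" for i j
      by (simp add: matrix_matrix_mult_def matrix_vector_mult_def transpose_def inner_vec_def P_def)
    moreover have "b i \<bullet> (?A *v b j) = (if i = j then 1 else 0)" for i j
      using on[of "b i" "b j"] b by (auto simp: bij_betw_def inj_on_def)
    ultimately show ?thesis by (simp add: vec_eq_iff mat_def)
  qed
  then have invP: "invertible P"
    by (metis invertible_left_inverse matrix_mul_assoc)
  have "(?A ** P) ** transpose P = mat 1" using PAP matrix_left_right_inverse by blast
  then have "P ** transpose P = \<Sigma>"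
    using matrix_inv_eqI[of ?A "P ** transpose P"] by (simp add: matrix_mul_assoc matrix_inv_matrix_inv inv)
  moreover have "(P *v y) \<bullet> (?A *v (P *v y)) = y \<bullet> y" for y
  proof -
    have "(P *v y) \<bullet> (?A *v (P *v y)) = y \<bullet> ((transpose P ** (?A ** P)) *v y)"
      by (simp add: inner_matrix_transpose matrix_vector_mul_assoc matrix_mul_assoc)
    then show ?thesis by (simp add: PAP)
  qed
  ultimately show ?thesis using invP by (intro that[of P])
qed

section \<open>Lebesgue measure under linear maps\<close>

lemma nn_integral_lborel_coordinate:
  fixes h :: "'b::euclidean_space \<Rightarrow> ennreal"
  assumes [measurable]: "h \<in> borel_measurable borel" and e: "e \<in> Basis"
  shows "(\<integral>\<^sup>+x. h x \<partial>lborel) =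
    (\<integral>\<^sup>+x. (\<integral>\<^sup>+y. h ((\<Sum>b\<in>Basis - {e}. x b *\<^sub>R b) + y *\<^sub>R e) \<partial>lborel) \<partial>Pi\<^sub>M (Basis - {e}) (\<lambda>_. lborel))"
proof -
  interpret product_sigma_finite "\<lambda>_::'b. lborel :: real measure" ..
  have B: "insert e (Basis - {e}) = Basis" using e by auto
  have "(\<integral>\<^sup>+x. h x \<partial>lborel) = (\<integral>\<^sup>+f. h (\<Sum>b\<in>Basis. f b *\<^sub>R b) \<partial>Pi\<^sub>M (insert e (Basis - {e})) (\<lambda>_. lborel))"
    unfolding B by (subst lborel_def) (simp add: nn_integral_distr lborel_eq_real[symmetric])
  also have "\<dots> = (\<integral>\<^sup>+x. (\<integral>\<^sup>+y. h (\<Sum>b\<in>Basis. (x(e := y)) b *\<^sub>R b) \<partial>lborel) \<partial>Pi\<^sub>M (Basis - {e}) (\<lambda>_. lborel))"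
    by (rule product_nn_integral_insert) (auto simp: B)
  also have "\<dots> = (\<integral>\<^sup>+x. (\<integral>\<^sup>+y. h ((\<Sum>b\<in>Basis - {e}. x b *\<^sub>R b) + y *\<^sub>R e) \<partial>lborel) \<partial>Pi\<^sub>M (Basis - {e}) (\<lambda>_. lborel))"
  proof -
    have "(\<Sum>b\<in>Basis. (x(e := y)) b *\<^sub>R b) = (\<Sum>b\<in>Basis - {e}. x b *\<^sub>R b) + y *\<^sub>R e" for x y
      by (simp add: sum.remove[OF finite_Basis e] add.commute)
    then show ?thesis by simp
  qed
  finally show ?thesis .
qed

text \<open>On every line in direction $e$ the shear is a translation, because $x\cdot d$ is constant along it.\<close>
lemma nn_integral_lborel_shear:
  fixes h :: "'b::euclidean_space \<Rightarrow> ennreal"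
  assumes [measurable]: "h \<in> borel_measurable borel" and e: "e \<in> Basis" and d: "d \<in> Basis" and "d \<noteq> e"
  shows "(\<integral>\<^sup>+x. h (x + (x \<bullet> d) *\<^sub>R e) \<partial>lborel) = (\<integral>\<^sup>+x. h x \<partial>lborel)"
proof -
  have "(\<integral>\<^sup>+y. h (w + y *\<^sub>R e + ((w + y *\<^sub>R e) \<bullet> d) *\<^sub>R e) \<partial>lborel) = (\<integral>\<^sup>+y. h (w + y *\<^sub>R e) \<partial>lborel)" for w
  proof -
    have "(\<integral>\<^sup>+y. h (w + y *\<^sub>R e + ((w + y *\<^sub>R e) \<bullet> d) *\<^sub>R e) \<partial>lborel) = (\<integral>\<^sup>+y. h (w + (w \<bullet> d + y) *\<^sub>R e) \<partial>lborel)"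
      using assms by (intro nn_integral_cong) (simp add: inner_add_left inner_not_same_Basis scaleR_add_left add_ac)
    also have "\<dots> = (\<integral>\<^sup>+y. h (w + y *\<^sub>R e) \<partial>distr lborel borel ((+) (w \<bullet> d)))"
      by (subst nn_integral_distr) auto
    finally show ?thesis by (simp add: lborel_distr_plus)
  qed
  then show ?thesis
    by (simp add: nn_integral_lborel_coordinate[OF _ e])
qed

text \<open>A linear map is a product of diagonal maps, transpositions of two coordinates and elementary shears;
the claim is multiplicative, so these generators suffice.\<close>
lemma emeasure_lborel_linear_vimage:
  fixes f :: "real ^ 'p \<Rightarrow> real ^ 'p"
  assumes "linear f" and "det (matrix f) \<noteq> 0"
  shows "\<forall>S\<in>sets borel. ennreal \<bar>det (matrix f)\<bar> * emeasure lborel (f -` S) = emeasure lborel S"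
proof -
  have meas: "f -` S \<in> sets borel" if "linear f" "S \<in> sets borel" for f :: "real ^ 'p \<Rightarrow> real ^ 'p" and S
    using measurable_sets[OF borel_measurable_continuous_onI[OF linear_continuous_on_compose[OF continuous_on_id that(1)]], of S] that(2)
    by simp
  have B: "(Basis :: (real ^ 'p) set) = (\<lambda>i. axis i 1) ` UNIV"
    by (auto simp: Basis_vec_def)
  have inj: "inj (\<lambda>i::'p. axis i (1::real))" by (auto simp: inj_on_def axis_eq_axis)
  have prod_B: "(\<Prod>b\<in>Basis. x \<bullet> b) = (\<Prod>i\<in>UNIV. x $ i)" for x :: "real ^ 'p"
    by (simp add: B prod.reindex[OF inj] inner_axis)
  have "det (matrix f) \<noteq> 0 \<longrightarrow>
    (\<forall>S\<in>sets borel. ennreal \<bar>det (matrix f)\<bar> * emeasure lborel (f -` S) = emeasure lborel S)" (is "?P f")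
  proof (rule induct_linear_elementary[OF \<open>linear f\<close>])
    fix f g :: "real ^ 'p \<Rightarrow> real ^ 'p"
    assume lin: "linear f" "linear g" and f: "?P f" and g: "?P g"
    have d: "det (matrix (f \<circ> g)) = det (matrix f) * det (matrix g)"
      by (simp add: matrix_compose[OF lin(2,1)] det_mul)
    show "?P (f \<circ> g)"
    proof (intro impI ballI)
      fix S :: "(real ^ 'p) set" assume nz: "det (matrix (f \<circ> g)) \<noteq> 0" and S: "S \<in> sets borel"
      have "ennreal \<bar>det (matrix (f \<circ> g))\<bar> * emeasure lborel ((f \<circ> g) -` S)
        = ennreal \<bar>det (matrix f)\<bar> * (ennreal \<bar>det (matrix g)\<bar> * emeasure lborel (g -` (f -` S)))"
        by (simp add: d abs_mult ennreal_mult vimage_comp mult_ac)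
      also have "\<dots> = emeasure lborel S"
        using nz d f g S meas[OF lin(1) S] by simp
      finally show "ennreal \<bar>det (matrix (f \<circ> g))\<bar> * emeasure lborel ((f \<circ> g) -` S) = emeasure lborel S" .
    qed
  next
    fix f :: "real ^ 'p \<Rightarrow> real ^ 'p" and i
    assume lin: "linear f" and 0: "\<And>x. f x $ i = 0"
    then have "\<not> inj f"
      by (metis (full_types) linear_injective_imp_surjective one_neq_zero surjE vec_component)
    then show "?P f" using det_nz_iff_inj[OF lin] by blast
  next
    fix c :: "'p \<Rightarrow> real"
    let ?h = "\<lambda>x::real ^ 'p. \<chi> i. c i * x $ i"
    have d: "det (matrix ?h) = prod c UNIV"
      by (subst det_diagonal) (auto simp: matrix_def axis_def)
    show "?P ?h"
    proof (intro impI ballI)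
      fix S :: "(real ^ 'p) set" assume nz: "det (matrix ?h) \<noteq> 0" and S: "S \<in> sets borel"
      \<comment> \<open>The diagonal entries re-indexed by basis vectors instead of coordinates.\<close>
      define c' where "c' = (\<lambda>b::real ^ 'p. c (THE i. b = axis i 1))"
      have c': "c' (axis i 1) = c i" for i
        by (simp add: c'_def axis_eq_axis)
      have ax: "axis j (1::real) $ i = (if j = i then 1 else 0)" for i j :: 'p by (auto simp: axis_def)
      have T: "(0 + (\<Sum>j\<in>Basis. (c' j * (x \<bullet> j)) *\<^sub>R j)) = ?h x" for x :: "real ^ 'p"
        by (simp add: B sum.reindex[OF inj] c' vec_eq_iff inner_axis ax if_distrib[of "\<lambda>z. _ * z"] cong: if_cong)
      have P: "(\<Prod>j\<in>Basis. \<bar>c' j\<bar>) = \<bar>prod c UNIV\<bar>"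
        by (simp add: B prod.reindex[OF inj] c' abs_prod)
      have "\<And>j. j \<in> Basis \<Longrightarrow> c' j \<noteq> 0" using nz d by (auto simp: B c')
      from lborel_affine_euclidean[OF this, of "\<lambda>j. j" 0, unfolded T P]
      have l: "lborel = density (distr lborel borel ?h) (\<lambda>_. ennreal \<bar>prod c UNIV\<bar>)" .
      have [measurable]: "?h \<in> borel_measurable borel"
        by (rule borel_measurable_continuous_onI) (intro continuous_intros)
      have "emeasure lborel S = emeasure (density (distr lborel borel ?h) (\<lambda>_. ennreal \<bar>prod c UNIV\<bar>)) S"
        using l by simp
      also have "\<dots> = ennreal \<bar>prod c UNIV\<bar> * emeasure lborel (?h -` S)"
        using S by (simp add: emeasure_density nn_integral_cmult_indicator emeasure_distr)
      finally show "ennreal \<bar>det (matrix ?h)\<bar> * emeasure lborel (?h -` S) = emeasure lborel S"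
        by (simp add: d)
    qed
  next
    fix m n :: 'p assume "m \<noteq> n"
    let ?t = "Transposition.transpose m n"
    let ?h = "\<lambda>v::real ^ 'p. \<chi> i. v $ ?t i"
    have "matrix ?h = transpose(\<chi> i j. mat 1 $ i $ ?t j)"
      by (auto simp: transpose_def axis_def mat_def matrix_def vec_eq_iff)
    then have d: "\<bar>det (matrix ?h)\<bar> = 1"
      by (simp add: det_permute_columns permutes_swap_id sign_swap_id abs_mult)
    have [measurable]: "?h \<in> borel_measurable borel"
      by (rule borel_measurable_continuous_onI) (intro continuous_intros)
    have "lborel = distr lborel borel ?h"
    proof (rule lborel_eqI)
      fix l u :: "real ^ 'p" assume le: "\<And>b. b \<in> Basis \<Longrightarrow> l \<bullet> b \<le> u \<bullet> b"
      have le': "l $ i \<le> u $ i" for i using le[of "axis i 1"] by (simp add: inner_axis)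
      have "?h -` box l u = box (?h l) (?h u)"
        by (auto simp: mem_box_cart) (metis transpose_involutory)+
      then have "emeasure (distr lborel borel ?h) (box l u) = emeasure lborel (box (?h l) (?h u))"
        by (simp add: emeasure_distr)
      also have "\<dots> = ennreal (\<Prod>b\<in>Basis. (?h u - ?h l) \<bullet> b)"
        using le' by (subst emeasure_lborel_box) (auto simp: Basis_vec_def inner_axis)
      also have "(\<Prod>b\<in>Basis. (?h u - ?h l) \<bullet> b) = (\<Prod>i\<in>UNIV. (u - l) $ ?t i)"
        by (simp add: prod_B)
      also have "\<dots> = (\<Prod>i\<in>UNIV. (u - l) $ i)"
        using prod.permute [OF permutes_swap_id[of m UNIV n], of "\<lambda>i. (u - l) $ i"] by (simp add: o_def)
      also have "\<dots> = (\<Prod>b\<in>Basis. (u - l) \<bullet> b)"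
        by (simp only: prod_B)
      finally show "emeasure (distr lborel borel ?h) (box l u) = ennreal (\<Prod>b\<in>Basis. (u - l) \<bullet> b)" .
    qed simp
    then have "emeasure lborel S = emeasure (distr lborel borel ?h) S" for S by simp
    then show "?P ?h" by (simp add: d emeasure_distr)
  next
    fix m n :: 'p assume mn: "m \<noteq> n"
    let ?h = "\<lambda>v::real ^ 'p. \<chi> i. if i = m then v $ m + v $ n else v $ i"
    have "matrix ?h = (\<chi> k. if k = m then row m (mat 1) + 1 *s row n (mat 1) else row k (mat 1))"
      by (auto simp: matrix_def vec_eq_iff axis_def row_def mat_def)
    then have d: "det (matrix ?h) = 1"
      using det_row_operation[OF mn, of "mat 1 :: real ^ 'p ^ 'p" 1] by simp
    have h: "?h v = v + (v \<bullet> axis n 1) *\<^sub>R axis m 1" for v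
      by (simp add: vec_eq_iff axis_def inner_axis[unfolded axis_def])
    have [measurable]: "?h \<in> borel_measurable borel"
      unfolding h by measurable
    have "emeasure lborel (?h -` S) = emeasure lborel S" if [measurable]: "S \<in> sets borel" for S
    proof -
      have "emeasure lborel (?h -` S) = (\<integral>\<^sup>+x. indicator (?h -` S) x \<partial>lborel)"
        using measurable_sets[of ?h borel borel S] by simp
      also have "\<dots> = (\<integral>\<^sup>+x. indicator S (x + (x \<bullet> axis n 1) *\<^sub>R axis m 1) \<partial>lborel)"
        unfolding h[symmetric] by (intro nn_integral_cong) (simp add: indicator_def)
      also have "\<dots> = (\<integral>\<^sup>+x. indicator S x \<partial>lborel)"
        using mn by (intro nn_integral_lborel_shear) (auto simp: axis_eq_axis)
      finally show ?thesis by simp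
    qed
    then show "?P ?h" by (simp add: d)
  qed
  with assms(2) show ?thesis by simp
qed

section \<open>The characteristic function of a multivariate Gaussian\<close>

text \<open>Fubini for products of functions of the single coordinates; it splits Gaussian integrals into
one-dimensional ones.\<close>
lemma integral_lborel_prod:
  fixes f :: "'b::euclidean_space \<Rightarrow> real \<Rightarrow> complex"
  assumes f: "\<And>b. b \<in> Basis \<Longrightarrow> integrable lborel (f b)"
  shows "(\<integral>x. (\<Prod>b\<in>Basis. f b (x \<bullet> b)) \<partial>lborel) = (\<Prod>b\<in>Basis. (\<integral>z. f b z \<partial>lborel))"
proof -
  interpret product_sigma_finite "\<lambda>_::'b. lborel :: real measure" ..
  have [measurable]: "f b \<in> borel_measurable borel" if "b \<in> Basis" for b
    using borel_measurable_integrable[OF f[OF that]] by simp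
  have "(\<integral>x. (\<Prod>b\<in>Basis. f b (x \<bullet> b)) \<partial>lborel)
    = (\<integral>y. (\<Prod>b\<in>Basis. f b ((\<Sum>c\<in>Basis. y c *\<^sub>R c) \<bullet> b)) \<partial>Pi\<^sub>M (Basis :: 'b set) (\<lambda>_. lborel))"
    by (subst lborel_def) (simp add: integral_distr lborel_eq_real[symmetric] del: inner_sum_left_Basis)
  also have "\<dots> = (\<integral>y. (\<Prod>b\<in>Basis. f b (y b)) \<partial>Pi\<^sub>M (Basis :: 'b set) (\<lambda>_. lborel))"
    by simp
  also have "\<dots> = (\<Prod>b\<in>Basis. (\<integral>z. f b z \<partial>lborel))"
    by (rule product_integral_prod) (simp_all add: f)
  finally show ?thesis .
qed

lemma borel_measurable_matrix_vector_mult [measurable (raw)]: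
  fixes A :: "real ^ 'p ^ 'p"
  assumes [measurable]: "X \<in> borel_measurable N"
  shows "(\<lambda>\<omega>. A *v X \<omega>) \<in> borel_measurable N"
proof -
  have [measurable]: "(*v) A \<in> borel_measurable borel"
    by (intro borel_measurable_continuous_onI linear_continuous_on linear_conv_bounded_linear[THEN iffD1]) simp
  show ?thesis by measurable
qed

text \<open>With $\Sigma=PP^\top$ the substitution $x=Py$ turns the density into the product of standard normal
densities, since $|\det P|=\sqrt{\det\Sigma}$, and $t\cdot x$ into $(P^\top t)\cdot y$. What remains is
a product of one-dimensional characteristic functions with value $e^{-|P^\top t|^2/2}$.\<close>
lemma gaussian_characteristic_function:
  fixes \<Sigma> :: "real ^ 'p ^ 'p"
  assumes "pos_definite \<Sigma>"
  shows "(CLINT x|gaussian \<Sigma>. iexp (t \<bullet> x)) = exp (- (t \<bullet> (\<Sigma> *v t)) / 2)"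
proof -
  obtain P :: "real ^ 'p ^ 'p" where P: "P ** transpose P = \<Sigma>" "invertible P"
    and quad: "\<And>y. (P *v y) \<bullet> (matrix_inv \<Sigma> *v (P *v y)) = y \<bullet> y"
    by (rule pos_definite_factorization[OF assms]) blast
  have dP: "det P \<noteq> 0" using P(2) by (simp add: invertible_det_nz)
  have d\<Sigma>: "det \<Sigma> = (det P)\<^sup>2" by (simp add: P(1)[symmetric] det_mul power2_eq_square)
  have [measurable]: "(*v) A \<in> borel_measurable borel" for A :: "real ^ 'p ^ 'p"
    by (rule borel_measurable_matrix_vector_mult) simp
  \<comment> \<open>The change of variables $x=Py$, stated as an identity of measures.\<close>
  have lb: "lborel = density (distr lborel borel ((*v) P)) (\<lambda>_. ennreal \<bar>det P\<bar>)"
  proof (rule measure_eqI)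
    fix S :: "(real ^ 'p) set" assume "S \<in> sets lborel"
    then show "emeasure lborel S = emeasure (density (distr lborel borel ((*v) P)) (\<lambda>_. ennreal \<bar>det P\<bar>)) S"
      using emeasure_lborel_linear_vimage[of "(*v) P"] dP
      by (simp add: emeasure_density nn_integral_cmult_indicator emeasure_distr)
  qed simp
  define g where "g x = exp (- (x \<bullet> (matrix_inv \<Sigma> *v x)) / 2) / sqrt ((2 * pi) ^ CARD('p) * det \<Sigma>)" for x
  have g_meas [measurable]: "g \<in> borel_measurable borel"
    unfolding g_def by measurable
  have g_nonneg: "0 \<le> g x" for x by (simp add: g_def d\<Sigma>)
  have g_P: "\<bar>det P\<bar> * g (P *v y) = (\<Prod>b\<in>Basis. std_normal_density (y \<bullet> b))" for y
  proof -
    have "(\<Prod>b\<in>Basis. std_normal_density (y \<bullet> b)) = (\<Prod>b\<in>Basis. exp (- (y \<bullet> b)\<^sup>2 / 2)) / sqrt (2 * pi) ^ CARD('p)"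
      by (simp add: std_normal_density_def prod_dividef)
    also have "(\<Prod>b\<in>Basis. exp (- (y \<bullet> b)\<^sup>2 / 2)) = exp (- (y \<bullet> y) / 2)"
      by (simp add: exp_sum[symmetric] euclidean_inner[of y y] power2_eq_square sum_negf sum_divide_distrib)
    finally have eq: "(\<Prod>b\<in>Basis. std_normal_density (y \<bullet> b)) = exp (- (y \<bullet> y) / 2) / sqrt (2 * pi) ^ CARD('p)" .
    have "sqrt ((2 * pi) ^ CARD('p) * det \<Sigma>) = sqrt (2 * pi) ^ CARD('p) * \<bar>det P\<bar>"
      unfolding real_sqrt_mult[of "(2 * pi) ^ CARD('p)"] real_sqrt_power by (simp add: d\<Sigma>)
    then show ?thesis
      using dP by (simp only: g_def quad eq) simp
  qed
  define s where "s = transpose P *v t"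
  have s: "t \<bullet> (P *v y) = s \<bullet> y" for y
    unfolding s_def by (metis inner_commute inner_matrix_transpose)
  have ss: "s \<bullet> s = t \<bullet> (\<Sigma> *v t)"
    unfolding s[symmetric] unfolding s_def P(1)[symmetric] matrix_vector_mul_assoc ..
  have "(CLINT x|gaussian \<Sigma>. iexp (t \<bullet> x)) = (CLINT x|lborel. g x *\<^sub>R iexp (t \<bullet> x))"
    unfolding gaussian_def g_def[symmetric] by (rule integral_density) (auto simp: g_nonneg)
  also have "\<dots> = (CLINT y|lborel. \<bar>det P\<bar> *\<^sub>R (g (P *v y) *\<^sub>R iexp (t \<bullet> (P *v y))))"
    by (subst lb) (simp add: integral_density integral_distr)
  also have "\<dots> = (CLINT y|lborel. (\<Prod>b\<in>Basis. std_normal_density (y \<bullet> b) *\<^sub>R iexp ((s \<bullet> b) * (y \<bullet> b))))"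
  proof (rule Bochner_Integration.integral_cong[OF refl])
    fix y
    have "iexp (s \<bullet> y) = (\<Prod>b\<in>Basis. iexp ((s \<bullet> b) * (y \<bullet> b)))"
      by (simp add: exp_sum[symmetric] euclidean_inner[of s y] sum_distrib_left)
    then show "\<bar>det P\<bar> *\<^sub>R (g (P *v y) *\<^sub>R iexp (t \<bullet> (P *v y)))
      = (\<Prod>b\<in>Basis. std_normal_density (y \<bullet> b) *\<^sub>R iexp ((s \<bullet> b) * (y \<bullet> b)))"
      by (simp add: s g_P scaleR_conv_of_real prod.distrib del: of_real_mult flip: of_real_prod g_P mult.assoc)
         (simp add: mult.assoc[symmetric] of_real_mult[symmetric] del: of_real_mult)
  qed
  also have "\<dots> = (\<Prod>b\<in>Basis. (CLINT z|lborel. std_normal_density z *\<^sub>R iexp ((s \<bullet> b) * z)))"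
  proof (rule integral_lborel_prod)
    fix b :: "real ^ 'p"
    show "integrable lborel (\<lambda>z. std_normal_density z *\<^sub>R iexp ((s \<bullet> b) * z))"
      by (rule Bochner_Integration.integrable_bound[OF integrable_normal_density[OF zero_less_one, of 0]]) auto
  qed
  also have "\<dots> = (\<Prod>b\<in>Basis. complex_of_real (exp (- (s \<bullet> b)\<^sup>2 / 2)))"
  proof (rule prod.cong[OF refl])
    fix b :: "real ^ 'p"
    have "(CLINT z|lborel. std_normal_density z *\<^sub>R iexp ((s \<bullet> b) * z)) = char std_normal_distribution (s \<bullet> b)"
      unfolding char_def by (subst integral_density) auto
    then show "(CLINT z|lborel. std_normal_density z *\<^sub>R iexp ((s \<bullet> b) * z)) = complex_of_real (exp (- (s \<bullet> b)\<^sup>2 / 2))"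
      by (simp add: char_std_normal_distribution)
  qed
  also have "\<dots> = complex_of_real (exp (- (s \<bullet> s) / 2))"
    by (simp add: exp_sum[symmetric] euclidean_inner[of s s] power2_eq_square sum_negf sum_divide_distrib flip: of_real_prod)
  finally show ?thesis by (simp add: ss)
qed

text \<open>The total mass is the characteristic function at $0$.\<close>
lemma prob_space_gaussian:
  fixes \<Sigma> :: "real ^ 'p ^ 'p"
  assumes "pos_definite \<Sigma>"
  shows "prob_space (gaussian \<Sigma>)"
proof
  have "complex_of_real (measure (gaussian \<Sigma>) (space (gaussian \<Sigma>))) = 1"
    using gaussian_characteristic_function[OF assms, of 0] by (simp add: scaleR_conv_of_real)
  then have "measure (gaussian \<Sigma>) (space (gaussian \<Sigma>)) = 1" by simp
  then show "emeasure (gaussian \<Sigma>) (space (gaussian \<Sigma>)) = 1"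
    by (metis emeasure_eq_ennreal_measure ennreal_1 measure_def zero_neq_one enn2real_top)
qed

section \<open>Limit theorems for the rows of an array\<close>

lemma (in prob_space) indep_vars_reindex:
  assumes inj: "inj_on f I" and ind: "indep_vars N X (f ` I)"
  shows "indep_vars (\<lambda>i. N (f i)) (\<lambda>i. X (f i)) I"
  unfolding indep_vars_def2
proof (intro conjI ballI)
  show "random_variable (N (f i)) (X (f i))" if "i \<in> I" for i
    using ind that by (auto simp: indep_vars_def2)
  define F where "F j = {X j -` A \<inter> space M |A. A \<in> sets (N j)}" for j
  have F: "indep_sets F (f ` I)" using ind by (simp add: indep_vars_def2 F_def[abs_def])
  have "indep_sets (\<lambda>i. F (f i)) I"
  proof (rule indep_setsI)
    show "F (f i) \<subseteq> events" if "i \<in> I" for i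
      using F that by (auto simp: indep_sets_def)
    fix A J assume J: "J \<noteq> {}" "J \<subseteq> I" "finite J" and A: "\<forall>j\<in>J. A j \<in> F (f j)"
    have injJ: "inj_on f J" using inj J(2) by (rule inj_on_subset)
    have inv: "A (the_inv_into J f (f j)) = A j" if "j \<in> J" for j
      using that injJ by (simp add: the_inv_into_f_f)
    have "prob (\<Inter>j\<in>f ` J. A (the_inv_into J f j)) = (\<Prod>j\<in>f ` J. prob (A (the_inv_into J f j)))"
      using J A inv by (intro indep_setsD[OF F]) auto
    then show "prob (\<Inter> (A ` J)) = (\<Prod>j\<in>J. prob (A j))"
      using inv by (simp add: prod.reindex[OF injJ])
  qed
  then show "indep_sets (\<lambda>i. {X (f i) -` A \<inter> space M |A. A \<in> sets (N (f i))}) I"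
    by (simp add: F_def)
qed

text \<open>Independent centred variables are orthogonal in $L^2$, so the mixed terms of the square vanish.\<close>
lemma (in prob_space) square_sum_indep_centred:
  fixes Y :: "'i \<Rightarrow> 'a \<Rightarrow> real"
  assumes I: "finite I" and ind: "indep_vars (\<lambda>_. borel) Y I"
    and sq: "\<And>i. i \<in> I \<Longrightarrow> integrable M (\<lambda>\<omega>. (Y i \<omega>)\<^sup>2)"
    and centred: "\<And>i. i \<in> I \<Longrightarrow> expectation (Y i) = 0"
  shows integrable_square_sum_indep: "integrable M (\<lambda>\<omega>. (\<Sum>i\<in>I. Y i \<omega>)\<^sup>2)"
    and expectation_square_sum_indep:
      "expectation (\<lambda>\<omega>. (\<Sum>i\<in>I. Y i \<omega>)\<^sup>2) = (\<Sum>i\<in>I. expectation (\<lambda>\<omega>. (Y i \<omega>)\<^sup>2))"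
proof -
  have int: "integrable M (Y i)" if "i \<in> I" for i
  proof (rule square_integrable_imp_integrable[OF _ sq[OF that]])
    show "Y i \<in> borel_measurable M" using ind that by (simp add: indep_vars_def2)
  qed
  have *: "integrable M (\<lambda>\<omega>. Y i \<omega> * Y j \<omega>)"
    "expectation (\<lambda>\<omega>. Y i \<omega> * Y j \<omega>) = (if i = j then expectation (\<lambda>\<omega>. (Y i \<omega>)\<^sup>2) else 0)"
    if ij: "i \<in> I" "j \<in> I" for i j
  proof -
    consider "i = j" | "i \<noteq> j" by blast
    then have "integrable M (\<lambda>\<omega>. Y i \<omega> * Y j \<omega>) \<and>
      expectation (\<lambda>\<omega>. Y i \<omega> * Y j \<omega>) = (if i = j then expectation (\<lambda>\<omega>. (Y i \<omega>)\<^sup>2) else 0)"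
    proof cases
      case 1 then show ?thesis using sq[OF ij(1)] by (simp add: power2_eq_square)
    next
      case 2
      have "indep_vars (\<lambda>_. borel) Y {i, j}"
        using ij by (intro indep_vars_subset[OF ind]) auto
      from indep_vars_integrable[OF _ this] indep_vars_lebesgue_integral[OF _ this] 2
      show ?thesis using int[OF ij(1)] int[OF ij(2)] by (auto simp: centred[OF ij(1)])
    qed
    then show "integrable M (\<lambda>\<omega>. Y i \<omega> * Y j \<omega>)"
      "expectation (\<lambda>\<omega>. Y i \<omega> * Y j \<omega>) = (if i = j then expectation (\<lambda>\<omega>. (Y i \<omega>)\<^sup>2) else 0)" by auto
  qed
  have eq: "(\<Sum>i\<in>I. Y i \<omega>)\<^sup>2 = (\<Sum>i\<in>I. \<Sum>j\<in>I. Y i \<omega> * Y j \<omega>)" for \<omega>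
    by (simp add: power2_eq_square sum_product)
  show "integrable M (\<lambda>\<omega>. (\<Sum>i\<in>I. Y i \<omega>)\<^sup>2)"
    unfolding eq by (intro Bochner_Integration.integrable_sum *)
  have "expectation (\<lambda>\<omega>. (\<Sum>i\<in>I. Y i \<omega>)\<^sup>2) = (\<Sum>i\<in>I. \<Sum>j\<in>I. expectation (\<lambda>\<omega>. Y i \<omega> * Y j \<omega>))"
    unfolding eq by (subst Bochner_Integration.integral_sum, intro Bochner_Integration.integrable_sum *, assumption+)
      (intro sum.cong[OF refl] Bochner_Integration.integral_sum *, assumption+)
  also have "\<dots> = (\<Sum>i\<in>I. expectation (\<lambda>\<omega>. (Y i \<omega>)\<^sup>2))"
    using I by (intro sum.cong[OF refl]) (simp add: *(2) cong: sum.cong)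
  finally show "expectation (\<lambda>\<omega>. (\<Sum>i\<in>I. Y i \<omega>)\<^sup>2) = (\<Sum>i\<in>I. expectation (\<lambda>\<omega>. (Y i \<omega>)\<^sup>2))" .
qed

text \<open>Only a first moment is available, so the variables are truncated at level $K$. The truncated and
centred average has second moment at most $(2K)^2/n$, and the truncation error is at most
$\delta_K=\int |x-f_K(x)|\,d\mu$ in mean, uniformly in $n$, with $\delta_K\to0$. For each $n$ this estimate concerns a single row, so nothing
relates different rows except the common law $\mu$.\<close>
lemma (in prob_space) weak_law_identical_rows:
  fixes X :: "nat \<Rightarrow> nat \<Rightarrow> 'a \<Rightarrow> real"
  assumes ind: "\<And>n. indep_vars (\<lambda>_. borel) (X n) {1..n}"
    and distr: "\<And>n i. i \<in> {1..n} \<Longrightarrow> distr M borel (X n i) = \<mu>"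
    and int: "integrable \<mu> (\<lambda>x. x)"
  shows "(\<lambda>n. expectation (\<lambda>\<omega>. \<bar>(\<Sum>i=1..n. X n i \<omega>) / real n - integral\<^sup>L \<mu> (\<lambda>x. x)\<bar>)) \<longlonglongrightarrow> 0"
proof -
  define m where "m = integral\<^sup>L \<mu> (\<lambda>x. x)"
  have X [measurable]: "X n i \<in> borel_measurable M" if "i \<in> {1..n}" for n i
    using ind[of n] that by (auto simp: indep_vars_def2)
  have \<mu>: "\<mu> = distr M borel (X 1 1)" using distr[of 1 1] by simp
  interpret \<mu>: prob_space \<mu> unfolding \<mu> by (rule prob_space_distr) simp
  have [measurable_cong]: "sets \<mu> = sets borel" by (simp add: \<mu>)
  define f where "f K x = (if \<bar>x\<bar> \<le> real K then x else 0)" for K and x :: real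
  have f_meas [measurable]: "f K \<in> borel_measurable borel" for K
    unfolding f_def by measurable
  have f_le: "\<bar>f K x\<bar> \<le> real K" "\<bar>x - f K x\<bar> \<le> \<bar>x\<bar>" for K x by (auto simp: f_def)
  have int_f: "integrable \<mu> (f K)" for K
    by (rule \<mu>.integrable_const_bound[of _ "real K"]) (auto simp: f_le)
  have transfer: "integrable M (\<lambda>\<omega>. h (X n i \<omega>))" "expectation (\<lambda>\<omega>. h (X n i \<omega>)) = integral\<^sup>L \<mu> h"
    if "i \<in> {1..n}" "integrable \<mu> h" for n i and h :: "real \<Rightarrow> real"
  proof -
    have [measurable]: "h \<in> borel_measurable borel" using borel_measurable_integrable[OF that(2)] by simp
    show "integrable M (\<lambda>\<omega>. h (X n i \<omega>))"
      using that distr[OF that(1)] integrable_distr_eq[of "X n i" M borel h] X[OF that(1)] by simp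
    show "expectation (\<lambda>\<omega>. h (X n i \<omega>)) = integral\<^sup>L \<mu> h"
      using distr[OF that(1)] integral_distr[of "X n i" M borel h] X[OF that(1)] by simp
  qed
  define \<delta> where "\<delta> K = integral\<^sup>L \<mu> (\<lambda>x. \<bar>x - f K x\<bar>)" for K
  have int_\<delta>: "integrable \<mu> (\<lambda>x. \<bar>x - f K x\<bar>)" for K
    using int int_f by (intro integrable_abs Bochner_Integration.integrable_diff)
  have "\<delta> \<longlonglongrightarrow> integral\<^sup>L \<mu> (\<lambda>x. 0)"
    unfolding \<delta>_def
  proof (rule integral_dominated_convergence[where w="\<lambda>x. \<bar>x\<bar>"])
    show "AE x in \<mu>. (\<lambda>K. \<bar>x - f K x\<bar>) \<longlonglongrightarrow> 0"
    proof (rule AE_I2)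
      fix x :: real
      obtain N :: nat where "\<bar>x\<bar> \<le> real N" using real_arch_simple by blast
      then show "(\<lambda>K. \<bar>x - f K x\<bar>) \<longlonglongrightarrow> 0"
        by (intro tendsto_eventually eventually_sequentiallyI[of N]) (auto simp: f_def)
    qed
    show "integrable \<mu> (\<lambda>x. \<bar>x\<bar>)" using int by (rule integrable_abs)
    show "AE x in \<mu>. norm \<bar>x - f K x\<bar> \<le> \<bar>x\<bar>" for K using f_le(2)[of _ K] by simp
    show "(\<lambda>x. \<bar>x - f K x\<bar>) \<in> borel_measurable \<mu>" for K
      using int_\<delta> by (rule borel_measurable_integrable)
  qed simp
  then have \<delta>_lim: "\<delta> \<longlonglongrightarrow> 0" by simp
  have bound: "expectation (\<lambda>\<omega>. \<bar>(\<Sum>i=1..n. X n i \<omega>) / real n - m\<bar>)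
    \<le> e + (2 * real K)\<^sup>2 / (real n * e) + 2 * \<delta> K" if "e > 0" "n \<ge> 1" for e n K
  proof -
    define c where "c = integral\<^sup>L \<mu> (f K)"
    have c: "\<bar>c\<bar> \<le> real K"
    proof -
      have "f K x \<le> real K" "- real K \<le> f K x" for x using f_le(1)[of K x] by linarith+
      then show ?thesis
        unfolding c_def using \<mu>.integral_le_const[OF int_f, of K "real K"] \<mu>.integral_ge_const[OF int_f, of "- real K" K]
        by simp
    qed
    have mc: "\<bar>c - m\<bar> \<le> \<delta> K"
    proof -
      have "m - c = integral\<^sup>L \<mu> (\<lambda>x. x - f K x)" using int int_f by (simp add: m_def c_def)
      then show ?thesis unfolding \<delta>_def using integral_abs_bound[of \<mu> "\<lambda>x. x - f K x"] by linarith
    qed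
    define Y where "Y i \<omega> = f K (X n i \<omega>) - c" for i \<omega>
    define S where "S \<omega> = (\<Sum>i=1..n. Y i \<omega>) / real n" for \<omega>
    have indY: "indep_vars (\<lambda>_. borel) Y {1..n}"
      unfolding Y_def[abs_def] by (rule indep_vars_compose2[OF ind]) measurable
    have Y2: "(Y i \<omega>)\<^sup>2 \<le> (2 * real K)\<^sup>2" for i \<omega>
    proof -
      have "\<bar>Y i \<omega>\<bar> \<le> 2 * real K" using c f_le(1)[of K "X n i \<omega>"] unfolding Y_def by linarith
      then show ?thesis by (metis abs_ge_zero power2_abs power_mono)
    qed
    have Ymeas: "Y i \<in> borel_measurable M" if "i \<in> {1..n}" for i
      using X[OF that] unfolding Y_def[abs_def] by measurable
    have intY2: "integrable M (\<lambda>\<omega>. (Y i \<omega>)\<^sup>2)" if "i \<in> {1..n}" for i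
      by (rule integrable_const_bound[of _ "(2 * real K)\<^sup>2"]) (use Y2 Ymeas[OF that] in auto)
    have EY: "expectation (Y i) = 0" if "i \<in> {1..n}" for i
      unfolding Y_def[abs_def] using transfer[OF that int_f] by (simp add: c_def prob_space)
    have intS: "integrable M (\<lambda>\<omega>. (S \<omega>)\<^sup>2)" 
      unfolding S_def power_divide
      by (intro integrable_divide_zero impI integrable_square_sum_indep[OF _ indY intY2 EY]) auto
    have "expectation (\<lambda>\<omega>. (S \<omega>)\<^sup>2) = (\<Sum>i=1..n. expectation (\<lambda>\<omega>. (Y i \<omega>)\<^sup>2)) / (real n)\<^sup>2"
      unfolding S_def power_divide
      using expectation_square_sum_indep[OF _ indY intY2 EY] by simp
    also have "\<dots> \<le> (\<Sum>i=1..n. (2 * real K)\<^sup>2) / (real n)\<^sup>2"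
      using Y2 intY2 by (intro divide_right_mono sum_mono integral_le_const) auto
    also have "\<dots> = (2 * real K)\<^sup>2 / real n" using that by (simp add: power2_eq_square)
    finally have ES: "expectation (\<lambda>\<omega>. (S \<omega>)\<^sup>2) \<le> (2 * real K)\<^sup>2 / real n" .
    define R where "R \<omega> = (\<Sum>i=1..n. \<bar>X n i \<omega> - f K (X n i \<omega>)\<bar>) / real n" for \<omega>
    have intR: "integrable M R"
      unfolding R_def[abs_def]
      by (intro integrable_divide_zero impI Bochner_Integration.integrable_sum transfer(1)[OF _ int_\<delta>])
    have "expectation R = (\<Sum>i=1..n. \<delta> K) / real n"
      unfolding R_def[abs_def] \<delta>_def using transfer[OF _ int_\<delta>]
      by (simp add: Bochner_Integration.integral_sum)
    then have ER: "expectation R = \<delta> K" using that by simp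
    have pointwise: "\<bar>(\<Sum>i=1..n. X n i \<omega>) / real n - m\<bar> \<le> e + (S \<omega>)\<^sup>2 / e + R \<omega> + \<delta> K" for \<omega>
    proof -
      have "(\<Sum>i=1..n. X n i \<omega>) / real n - m
        = S \<omega> + (\<Sum>i=1..n. X n i \<omega> - f K (X n i \<omega>)) / real n + (c - m)"
        using that by (simp add: S_def Y_def sum_subtractf field_simps)
      moreover have "\<bar>(\<Sum>i=1..n. X n i \<omega> - f K (X n i \<omega>)) / real n\<bar> \<le> R \<omega>"
        unfolding R_def by (simp add: abs_divide divide_right_mono sum_abs)
      moreover have "\<bar>S \<omega>\<bar> \<le> e + (S \<omega>)\<^sup>2 / e"
      proof (cases "\<bar>S \<omega>\<bar> \<le> e")
        case True then show ?thesis using that(1) by (simp add: add_increasing2)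
      next
        case False
        then have "e * \<bar>S \<omega>\<bar> \<le> \<bar>S \<omega>\<bar> * \<bar>S \<omega>\<bar>" by (intro mult_right_mono) auto
        then have "\<bar>S \<omega>\<bar> \<le> (S \<omega>)\<^sup>2 / e" using that(1) by (simp add: pos_le_divide_eq power2_eq_square mult.commute)
        then show ?thesis using that(1) by simp
      qed
      ultimately show ?thesis using mc by linarith
    qed
    have intX: "integrable M (\<lambda>\<omega>. \<bar>(\<Sum>i=1..n. X n i \<omega>) / real n - m\<bar>)"
      by (intro integrable_abs Bochner_Integration.integrable_diff integrable_divide_zero impI
          Bochner_Integration.integrable_sum transfer(1)[OF _ int] integrable_const)
    have "expectation (\<lambda>\<omega>. \<bar>(\<Sum>i=1..n. X n i \<omega>) / real n - m\<bar>)
      \<le> expectation (\<lambda>\<omega>. e + (S \<omega>)\<^sup>2 / e + R \<omega> + \<delta> K)"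
      using intX intS intR pointwise by (intro integral_mono) auto
    also have "\<dots> = e + expectation (\<lambda>\<omega>. (S \<omega>)\<^sup>2) / e + 2 * \<delta> K"
      using intS intR by (simp add: ER prob_space)
    also have "\<dots> \<le> e + (2 * real K)\<^sup>2 / real n / e + 2 * \<delta> K"
      using divide_right_mono[OF ES, of e] that(1) by simp
    finally show ?thesis by simp
  qed
  show ?thesis unfolding m_def[symmetric]
  proof (rule LIMSEQ_I)
    fix r :: real assume r: "0 < r"
    \<comment> \<open>With $e=r/8$ the three terms of the bound are below $r/8$, $r/8$ and $2r/8$.\<close>
    obtain K where K: "\<bar>\<delta> K\<bar> < r / 8" using LIMSEQ_D[OF \<delta>_lim, of "r / 8"] r by auto
    have "(\<lambda>n. (2 * real K)\<^sup>2 / (real n * (r / 8))) \<longlonglongrightarrow> 0"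
      using r by real_asymp
    then obtain N where N: "\<And>n. n \<ge> N \<Longrightarrow> \<bar>(2 * real K)\<^sup>2 / (real n * (r / 8))\<bar> < r / 8"
      using LIMSEQ_D[of _ 0 "r / 8"] r by (metis diff_zero divide_pos_pos real_norm_def zero_less_numeral)
    have "\<bar>expectation (\<lambda>\<omega>. \<bar>(\<Sum>i=1..n. X n i \<omega>) / real n - m\<bar>)\<bar> < r" if "n \<ge> max 1 N" for n
    proof -
      have "0 \<le> expectation (\<lambda>\<omega>. \<bar>(\<Sum>i=1..n. X n i \<omega>) / real n - m\<bar>)" by (rule Bochner_Integration.integral_nonneg) simp
      moreover have "(2 * real K)\<^sup>2 / (real n * (r / 8)) < r / 8" using le_less_trans[OF abs_ge_self N[of n]] that by simp
      ultimately show ?thesis using bound[of "r / 8" n K] r K that by simp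
    qed
    then show "\<exists>N. \<forall>n\<ge>N. norm (expectation (\<lambda>\<omega>. \<bar>(\<Sum>i=1..n. X n i \<omega>) / real n - m\<bar>) - 0) < r"
      by (intro exI[of _ "max 1 N"]) simp
  qed
qed

text \<open>The central limit theorem for sequences applies to the first column of the array. A row sum and
the corresponding partial sum of that column have the same characteristic function, namely a power
of the characteristic function of the common law.\<close>
lemma (in prob_space) characteristic_function_clt_rows:
  fixes X :: "nat \<Rightarrow> nat \<Rightarrow> 'a \<Rightarrow> real"
  assumes ind: "indep_vars (\<lambda>_. borel) (\<lambda>(n, i). X n i) {(n, i). 1 \<le> i \<and> i \<le> n}"
    and distr: "\<And>n i. 1 \<le> i \<Longrightarrow> i \<le> n \<Longrightarrow> distr M borel (X n i) = \<mu>"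
    and mean: "integral\<^sup>L \<mu> (\<lambda>x. x) = 0"
    and int: "integrable \<mu> (\<lambda>x. x\<^sup>2)" and var: "integral\<^sup>L \<mu> (\<lambda>x. x\<^sup>2) = \<sigma>\<^sup>2" and "\<sigma> > 0"
  shows "(\<lambda>n. CLINT \<omega>|M. iexp ((\<Sum>i=1..n. X n i \<omega>) / sqrt (real n))) \<longlonglongrightarrow> exp (- \<sigma>\<^sup>2 / 2)"
proof -
  have X [measurable]: "X n i \<in> borel_measurable M" if "1 \<le> i" "i \<le> n" for n i
    using ind that by (auto simp: indep_vars_def2)
  have row: "indep_vars (\<lambda>_. borel) (X n) {1..n}" for n
  proof -
    have sub: "Pair n ` {1..n} \<subseteq> {(n, i). 1 \<le> i \<and> i \<le> n}" by auto
    show ?thesis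
      using indep_vars_reindex[OF _ indep_vars_subset[OF ind sub]] by (simp add: inj_on_def)
  qed
  \<comment> \<open>The first column as a sequence; the shift is needed because rows are numbered from $1$.\<close>
  define Y where "Y k = X (Suc k) 1" for k
  have Y [measurable]: "Y k \<in> borel_measurable M" for k by (simp add: Y_def)
  have distrY: "distr M borel (Y k) = \<mu>" for k by (simp add: Y_def distr)
  have indY: "indep_vars (\<lambda>_. borel) Y UNIV"
  proof -
    have sub: "range (\<lambda>k. (Suc k, 1)) \<subseteq> {(n, i). 1 \<le> i \<and> i \<le> n}" by auto
    show ?thesis
      using indep_vars_reindex[OF _ indep_vars_subset[OF ind sub]] by (simp add: inj_on_def Y_def[abs_def])
  qed
  have EY: "expectation (Y k) = 0" for k
    unfolding mean[symmetric] distrY[of k, symmetric] by (simp add: integral_distr)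
  have EY2: "expectation (\<lambda>\<omega>. (Y k \<omega>)\<^sup>2) = \<sigma>\<^sup>2" for k
    unfolding var[symmetric] distrY[of k, symmetric] by (simp add: integral_distr)
  have intY2: "integrable M (\<lambda>\<omega>. (Y k \<omega>)\<^sup>2)" for k
    using int unfolding distrY[of k, symmetric] by (simp add: integrable_distr_eq)
  define D where "D n = distr M borel (\<lambda>\<omega>. (\<Sum>i<n. Y i \<omega>) / sqrt (real n * \<sigma>\<^sup>2))" for n
  have rd: "real_distribution (D n)" for n unfolding D_def by simp
  have "weak_conv_m D std_normal_distribution"
    unfolding D_def
    by (rule central_limit_theorem_zero_mean[OF indY EY \<open>\<sigma> > 0\<close> intY2 _ distrY]) (simp add: EY EY2)
  then have lim: "(\<lambda>n. char (D n) \<sigma>) \<longlonglongrightarrow> char std_normal_distribution \<sigma>"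
    by (intro levy_continuity1 rd) (auto intro: real_dist_normal_dist)
  have "char (D n) \<sigma> = (CLINT \<omega>|M. iexp ((\<Sum>i=1..n. X n i \<omega>) / sqrt (real n)))" for n
  proof -
    have "char (D n) \<sigma> = char (distr M borel (\<lambda>\<omega>. \<Sum>i<n. Y i \<omega>)) (1 / sqrt (real n))"
      using \<open>\<sigma> > 0\<close> by (simp add: D_def char_def integral_distr real_sqrt_mult)
    also have "\<dots> = char \<mu> (1 / sqrt (real n)) ^ n"
      by (subst char_distr_sum) (auto simp: distrY intro: indep_vars_subset[OF indY])
    also have "\<dots> = char (distr M borel (\<lambda>\<omega>. \<Sum>i=1..n. X n i \<omega>)) (1 / sqrt (real n))"
      by (subst char_distr_sum[OF row]) (simp add: distr)
    also have "\<dots> = (CLINT \<omega>|M. iexp ((\<Sum>i=1..n. X n i \<omega>) / sqrt (real n)))"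
    proof -
      have "(\<lambda>\<omega>. \<Sum>i=1..n. X n i \<omega>) \<in> borel_measurable M" by (intro borel_measurable_sum X) auto
      then show ?thesis by (simp add: char_def integral_distr)
    qed
    finally show ?thesis .
  qed
  with lim show ?thesis by (simp add: char_std_normal_distribution)
qed

section \<open>Convergence in law of quadratic forms\<close>

lemma sets_gaussian [simp, measurable_cong]: "sets (gaussian \<Sigma>) = sets borel"
  by (simp add: gaussian_def)

lemma space_gaussian [simp]: "space (gaussian \<Sigma>) = UNIV"
  by (simp add: gaussian_def)

lemma norm_integral_le_integral:
  fixes f :: "'a \<Rightarrow> 'b::{banach, second_countable_topology}"
  assumes "integrable N f" "integrable N g" "\<And>x. x \<in> space N \<Longrightarrow> norm (f x) \<le> g x"
  shows "norm (integral\<^sup>L N f) \<le> integral\<^sup>L N g"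
  using integral_norm_bound[of N f] integral_mono[OF integrable_norm[OF assms(1)] assms(2,3)] by linarith

text \<open>Linearisation of a quadratic exponent: the characteristic function of $\mathcal N(0,A)$ at
$\sqrt{2k}\,x$ is $e^{-k\,x^\top A x}$. Read from right to left and averaged over $X$ with Fubini, it
expresses the Laplace transform of $X^\top A X$ by the characteristic function of $X$.\<close>
lemma expectation_exp_quadratic_form:
  fixes A :: "real ^ 'p ^ 'p"
  assumes A: "pos_definite A" and N: "prob_space N" and X [measurable]: "X \<in> borel_measurable N" and "k \<ge> 0"
  shows "complex_of_real (\<integral>\<omega>. exp (- (k * (X \<omega> \<bullet> (A *v X \<omega>)))) \<partial>N)
    = (CLINT y|gaussian A. (CLINT \<omega>|N. iexp ((sqrt (2 * k) *\<^sub>R y) \<bullet> X \<omega>)))"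
proof -
  interpret N: prob_space N by fact
  interpret G: prob_space "gaussian A" by (rule prob_space_gaussian[OF A])
  interpret P: pair_prob_space N "gaussian A" ..
  have lin: "complex_of_real (exp (- (k * (X \<omega> \<bullet> (A *v X \<omega>)))))
    = (CLINT y|gaussian A. iexp ((sqrt (2 * k) *\<^sub>R y) \<bullet> X \<omega>))" for \<omega>
  proof -
    have "(CLINT y|gaussian A. iexp ((sqrt (2 * k) *\<^sub>R X \<omega>) \<bullet> y))
      = exp (- ((sqrt (2 * k) *\<^sub>R X \<omega>) \<bullet> (A *v (sqrt (2 * k) *\<^sub>R X \<omega>))) / 2)"
      by (rule gaussian_characteristic_function[OF A])
    also have "- ((sqrt (2 * k) *\<^sub>R X \<omega>) \<bullet> (A *v (sqrt (2 * k) *\<^sub>R X \<omega>))) / 2 = - (k * (X \<omega> \<bullet> (A *v X \<omega>)))"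
      using \<open>k \<ge> 0\<close> by (simp add: matrix_vector_mult_scaleR flip: mult.assoc)
    finally show ?thesis by (simp add: inner_commute)
  qed
  have int: "integrable (N \<Otimes>\<^sub>M gaussian A) (\<lambda>(\<omega>, y). iexp ((sqrt (2 * k) *\<^sub>R y) \<bullet> X \<omega>))"
    by (rule P.integrable_const_bound[of _ 1]) (auto simp: case_prod_beta)
  have "complex_of_real (\<integral>\<omega>. exp (- (k * (X \<omega> \<bullet> (A *v X \<omega>)))) \<partial>N)
    = (CLINT \<omega>|N. (CLINT y|gaussian A. iexp ((sqrt (2 * k) *\<^sub>R y) \<bullet> X \<omega>)))"
    unfolding lin[symmetric] by simp
  also have "\<dots> = (CLINT y|gaussian A. (CLINT \<omega>|N. iexp ((sqrt (2 * k) *\<^sub>R y) \<bullet> X \<omega>)))"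
    using P.Fubini_integral[OF int] by simp
  finally show ?thesis .
qed

text \<open>By the linearisation above this is dominated convergence under $\mathcal N(0,A)$, as characteristic
functions are bounded by $1$.\<close>
lemma laplace_transform_quadratic_form_tendsto:
  fixes U :: "nat \<Rightarrow> 'a \<Rightarrow> real ^ 'p" and V :: "'b \<Rightarrow> real ^ 'p"
  assumes A: "pos_definite A" and M: "prob_space M" and N: "prob_space N"
    and U: "\<And>n. U n \<in> borel_measurable M" and V: "V \<in> borel_measurable N"
    and char: "\<And>t. (\<lambda>n. CLINT \<omega>|M. iexp (t \<bullet> U n \<omega>)) \<longlonglongrightarrow> (CLINT v|N. iexp (t \<bullet> V v))"
    and "k \<ge> 0"
  shows "(\<lambda>n. \<integral>\<omega>. exp (- (k * (U n \<omega> \<bullet> (A *v U n \<omega>)))) \<partial>M) \<longlonglongrightarrow> (\<integral>v. exp (- (k * (V v \<bullet> (A *v V v)))) \<partial>N)"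
proof -
  interpret M: prob_space M by fact
  interpret N: prob_space N by fact
  interpret G: prob_space "gaussian A" by (rule prob_space_gaussian[OF A])
  note [measurable] = U V
  have "(\<lambda>n. CLINT y|gaussian A. (CLINT \<omega>|M. iexp ((sqrt (2 * k) *\<^sub>R y) \<bullet> U n \<omega>)))
    \<longlonglongrightarrow> (CLINT y|gaussian A. (CLINT v|N. iexp ((sqrt (2 * k) *\<^sub>R y) \<bullet> V v)))"
  proof (rule integral_dominated_convergence[where w="\<lambda>_. 1"])
    show "AE y in gaussian A. (\<lambda>n. CLINT \<omega>|M. iexp ((sqrt (2 * k) *\<^sub>R y) \<bullet> U n \<omega>))
        \<longlonglongrightarrow> (CLINT v|N. iexp ((sqrt (2 * k) *\<^sub>R y) \<bullet> V v))"
      by (intro AE_I2 char)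
    show "AE y in gaussian A. norm (CLINT \<omega>|M. iexp ((sqrt (2 * k) *\<^sub>R y) \<bullet> U n \<omega>)) \<le> 1" for n
    proof (intro AE_I2)
      fix y
      have "norm (CLINT \<omega>|M. iexp ((sqrt (2 * k) *\<^sub>R y) \<bullet> U n \<omega>)) \<le> (\<integral>\<omega>. 1 \<partial>M)"
        by (rule norm_integral_le_integral) (auto intro!: M.integrable_const_bound[of _ 1])
      then show "norm (CLINT \<omega>|M. iexp ((sqrt (2 * k) *\<^sub>R y) \<bullet> U n \<omega>)) \<le> 1" by (simp add: M.prob_space)
    qed
    show "(\<lambda>y. CLINT v|N. iexp ((sqrt (2 * k) *\<^sub>R y) \<bullet> V v)) \<in> borel_measurable (gaussian A)"
      by (intro N.borel_measurable_lebesgue_integral) measurable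
    show "(\<lambda>y. CLINT \<omega>|M. iexp ((sqrt (2 * k) *\<^sub>R y) \<bullet> U n \<omega>)) \<in> borel_measurable (gaussian A)" for n
      by (intro M.borel_measurable_lebesgue_integral) measurable
  qed simp
  then have "(\<lambda>n. complex_of_real (\<integral>\<omega>. exp (- (k * (U n \<omega> \<bullet> (A *v U n \<omega>)))) \<partial>M))
    \<longlonglongrightarrow> complex_of_real (\<integral>v. exp (- (k * (V v \<bullet> (A *v V v)))) \<partial>N)"
    unfolding expectation_exp_quadratic_form[OF A M U \<open>k \<ge> 0\<close>] expectation_exp_quadratic_form[OF A N V \<open>k \<ge> 0\<close>] .
  then show ?thesis by (simp only: tendsto_of_real_iff)
qed

text \<open>The hypothesis says that all moments of $e^{-Q_n}$ converge to those of $e^{-Q'}$. These variables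
have values in $[0,1]$, where polynomials are uniformly dense among the continuous functions.\<close>
lemma expectation_tendsto_from_laplace:
  fixes Q :: "nat \<Rightarrow> 'a \<Rightarrow> real" and Q' :: "'b \<Rightarrow> real" and g :: "real \<Rightarrow> real"
  assumes M: "prob_space M" and N: "prob_space N"
    and Q: "\<And>n. Q n \<in> borel_measurable M" "\<And>n \<omega>. 0 \<le> Q n \<omega>"
    and Q': "Q' \<in> borel_measurable N" "\<And>v. 0 \<le> Q' v"
    and laplace: "\<And>k::nat. (\<lambda>n. \<integral>\<omega>. exp (- (real k * Q n \<omega>)) \<partial>M) \<longlonglongrightarrow> (\<integral>v. exp (- (real k * Q' v)) \<partial>N)"
    and g: "continuous_on {0..1} g" and g_meas [measurable]: "g \<in> borel_measurable borel"
  shows "(\<lambda>n. \<integral>\<omega>. g (exp (- Q n \<omega>)) \<partial>M) \<longlonglongrightarrow> (\<integral>v. g (exp (- Q' v)) \<partial>N)"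
proof (rule LIMSEQ_I)
  fix r :: real assume r: "0 < r"
  interpret M: prob_space M by fact
  interpret N: prob_space N by fact
  note [measurable] = Q(1) Q'(1)
  obtain p where p: "real_polynomial_function p" and p_close: "\<And>x. x \<in> {0..1} \<Longrightarrow> \<bar>g x - p x\<bar> < r / 3"
    using Stone_Weierstrass_real_polynomial_function[OF compact_Icc g, of "r / 3"] r by auto
  obtain a d where p_eq: "p = (\<lambda>x. \<Sum>i\<le>d. a i * x ^ i)"
    using p real_polynomial_function_iff_sum by blast
  have [measurable]: "p \<in> borel_measurable borel" unfolding p_eq by measurable
  have pow: "exp (- q) ^ i = exp (- (real i * q))" for q :: real and i
    by (simp add: exp_of_nat_mult[symmetric])
  have bounded: "\<exists>B. \<forall>x\<in>{0..1}. \<bar>h x\<bar> \<le> B" if "continuous_on {0..1} h" for h :: "real \<Rightarrow> real"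
  proof -
    have "bounded (h ` {0..1})" using that by (intro compact_imp_bounded compact_continuous_image) auto
    then show ?thesis by (auto simp: bounded_iff)
  qed
  have approx: "\<bar>(\<integral>\<omega>. g (exp (- X \<omega>)) \<partial>L) - (\<Sum>i\<le>d. a i * (\<integral>\<omega>. exp (- (real i * X \<omega>)) \<partial>L))\<bar> \<le> r / 3"
    if L: "prob_space L" and X [measurable]: "X \<in> borel_measurable L" and X0: "\<And>\<omega>. 0 \<le> X \<omega>"
    for L :: "'c measure" and X
  proof -
    interpret L: prob_space L by fact
    have X01: "exp (- X \<omega>) \<in> {0..1}" for \<omega> using X0[of \<omega>] by simp
    have int: "integrable L (\<lambda>\<omega>. h (exp (- X \<omega>)))" if h: "continuous_on {0..1} h" "h \<in> borel_measurable borel" for h :: "real \<Rightarrow> real"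
    proof -
      obtain B where "\<forall>x\<in>{0..1}. \<bar>h x\<bar> \<le> B" using bounded[OF h(1)] by blast
      then show ?thesis using X01 h(2) by (intro L.integrable_const_bound[of _ B]) (auto simp del: atLeastAtMost_iff)
    qed
    have int_p: "integrable L (\<lambda>\<omega>. p (exp (- X \<omega>)))"
      by (rule int) (auto simp: p_eq intro!: continuous_intros)
    have "(\<Sum>i\<le>d. a i * (\<integral>\<omega>. exp (- (real i * X \<omega>)) \<partial>L)) = (\<integral>\<omega>. p (exp (- X \<omega>)) \<partial>L)"
    proof -
      have "integrable L (\<lambda>\<omega>. a i * exp (- (real i * X \<omega>)))" for i
        by (rule L.integrable_const_bound[of _ "\<bar>a i\<bar>"]) (auto simp: abs_mult X0 mult_left_le)
      then show ?thesis unfolding p_eq pow by (subst Bochner_Integration.integral_sum) auto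
    qed
    then have "(\<integral>\<omega>. g (exp (- X \<omega>)) \<partial>L) - (\<Sum>i\<le>d. a i * (\<integral>\<omega>. exp (- (real i * X \<omega>)) \<partial>L))
      = (\<integral>\<omega>. g (exp (- X \<omega>)) - p (exp (- X \<omega>)) \<partial>L)"
      using int[OF g g_meas] int_p by simp
    also have "\<bar>\<dots>\<bar> \<le> (\<integral>\<omega>. r / 3 \<partial>L)"
      unfolding real_norm_def[symmetric]
      using int[OF g g_meas] int_p p_close[OF X01]
      by (intro norm_integral_le_integral) (auto simp: less_imp_le)
    finally show ?thesis by (simp add: L.prob_space)
  qed
  have "(\<lambda>n. \<Sum>i\<le>d. a i * (\<integral>\<omega>. exp (- (real i * Q n \<omega>)) \<partial>M)) \<longlonglongrightarrow> (\<Sum>i\<le>d. a i * (\<integral>v. exp (- (real i * Q' v)) \<partial>N))"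
    by (intro tendsto_sum tendsto_mult tendsto_const laplace)
  from LIMSEQ_D[OF this, of "r / 3"] r obtain n0 where
    n0: "\<And>n. n \<ge> n0 \<Longrightarrow> \<bar>(\<Sum>i\<le>d. a i * (\<integral>\<omega>. exp (- (real i * Q n \<omega>)) \<partial>M)) - (\<Sum>i\<le>d. a i * (\<integral>v. exp (- (real i * Q' v)) \<partial>N))\<bar> < r / 3"
    by auto
  have "\<bar>(\<integral>\<omega>. g (exp (- Q n \<omega>)) \<partial>M) - (\<integral>v. g (exp (- Q' v)) \<partial>N)\<bar> < r" if "n \<ge> n0" for n
    using n0[OF that] approx[OF M Q, of n] approx[OF N Q'] by linarith
  then show "\<exists>n0. \<forall>n\<ge>n0. norm ((\<integral>\<omega>. g (exp (- Q n \<omega>)) \<partial>M) - (\<integral>v. g (exp (- Q' v)) \<partial>N)) < r"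
    by auto
qed

lemma continuous_on_cts_step: "a < b \<Longrightarrow> continuous_on S (cts_step a b)"
  using uniformly_continuous_imp_continuous[OF cts_step_uniformly_continuous] continuous_on_subset by blast

text \<open>In the variable $r=e^{-q}$ the expression $q-q^2$ reads $-\ln r-(\ln r)^2$. It tends to $-\infty$ as
$r\to0$, where the step function is constantly $1$; hence the value $1$ at $r=0$ makes the
composition continuous on all of $[0,1]$.\<close>
lemma continuous_on_cts_step_of_log:
  assumes "a < b"
  shows "continuous_on {0..1} (\<lambda>r. if r = 0 then 1 else cts_step a b (- ln r - (ln r)\<^sup>2))" (is "continuous_on _ ?g")
  unfolding continuous_on_eq_continuous_within
proof
  fix x :: real assume x: "x \<in> {0..1}"
  show "continuous (at x within {0..1}) ?g"
  proof (cases "x = 0")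
    case True
    have "filterlim (\<lambda>r::real. - ln r - (ln r)\<^sup>2) at_bot (at_right 0)" by real_asymp
    then have "\<forall>\<^sub>F r in at_right 0. - ln r - (ln r)\<^sup>2 \<le> a" by (simp add: filterlim_at_bot)
    then have "\<forall>\<^sub>F r in at_right 0. ?g r = 1"
      using eventually_at_right_less[of 0] by eventually_elim (auto simp: cts_step_def)
    then have "(?g \<longlongrightarrow> 1) (at_right 0)" by (rule tendsto_eventually)
    then show ?thesis using True by (simp add: continuous_within at_within_Icc_at_right)
  next
    case False
    then have x0: "0 < x" using x by simp
    have "isCont (\<lambda>r. cts_step a b (- ln r - (ln r)\<^sup>2)) x"
    proof (rule isCont_o2[where g="cts_step a b"])
      show "isCont (\<lambda>r. - ln r - (ln r)\<^sup>2) x" using x0 by (intro continuous_intros) auto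
      show "isCont (cts_step a b) (- ln x - (ln x)\<^sup>2)"
        using continuous_on_cts_step[OF assms, of UNIV] by (simp add: continuous_on_eq_continuous_at)
    qed
    moreover have ev: "\<forall>\<^sub>F r in nhds x. cts_step a b (- ln r - (ln r)\<^sup>2) = ?g r"
    proof -
      have "\<forall>\<^sub>F r in nhds x. r \<in> {0<..}" using x0 by (intro eventually_nhds_in_open) auto
      then show ?thesis by eventually_elim auto
    qed
    ultimately have "isCont ?g x" by (simp only: isCont_cong[OF ev])
    then show ?thesis by (rule continuous_at_imp_continuous_within)
  qed
qed

section \<open>Approximation outside events of small probability\<close>

text \<open>A form of Slutsky's theorem without limits in law: if $X_n\to x_0$ in probability and $U_n$ is tight,
then any property that holds locally around each point $(x_0,u)$ holds for $(X_n,U_n)$ outside an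
event of small probability. Tightness confines $U_n$ to a compact ball, and the tube lemma provides a
neighbourhood of $x_0$ that works for the whole ball. The exceptional event is named explicitly, so
that the property itself need not define a measurable set.\<close>
lemma (in prob_space) eventually_nbhd_with_high_probability:
  fixes X :: "nat \<Rightarrow> 'a \<Rightarrow> 'x::metric_space" and U :: "nat \<Rightarrow> 'a \<Rightarrow> 'u::euclidean_space"
  assumes X: "\<And>\<eta>. \<eta> > 0 \<Longrightarrow> (\<lambda>n. prob {\<omega> \<in> space M. \<eta> \<le> dist (X n \<omega>) x0}) \<longlonglongrightarrow> 0"
    and X_events: "\<And>n \<eta>. {\<omega> \<in> space M. \<eta> \<le> dist (X n \<omega>) x0} \<in> events"
    and U_meas [measurable]: "\<And>n. U n \<in> borel_measurable M"
    and U_int: "\<And>n. integrable M (\<lambda>\<omega>. (norm (U n \<omega>))\<^sup>2)"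
    and U_bound: "\<And>n. expectation (\<lambda>\<omega>. (norm (U n \<omega>))\<^sup>2) \<le> C"
    and P: "\<And>u. \<forall>\<^sub>F z in nhds (x0, u). P (fst z) (snd z)"
    and "e > 0"
  shows "\<forall>\<^sub>F n in sequentially. \<exists>G\<in>events. prob G \<le> e \<and> (\<forall>\<omega>\<in>space M - G. P (X n \<omega>) (U n \<omega>))"
proof -
  have C: "C \<ge> 0" using U_bound[of 0] by (smt (verit) Bochner_Integration.integral_nonneg zero_le_power2)
  \<comment> \<open>With this radius the Markov bound for leaving the ball is $(C+1)/R^2=e/2$; adding $1$ to $C$ keeps $R$ positive.\<close>
  define R where "R = sqrt (2 * (C + 1) / e)"
  have R: "R > 0" "R\<^sup>2 = 2 * (C + 1) / e" using C \<open>e > 0\<close> by (simp_all add: R_def)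
  define W where "W = interior {z. P (fst z) (snd z)}"
  have "(x0, u) \<in> W" for u
    using P[of u] by (auto simp: W_def interior_def eventually_nhds)
  then obtain X0 where X0: "x0 \<in> X0" "open X0" "X0 \<times> cball 0 R \<subseteq> W"
    using Elementary_Topology.tube_lemma[of "cball 0 R" W x0] by (auto simp: W_def)
  obtain \<eta> where \<eta>: "\<eta> > 0" "\<And>x. dist x x0 < \<eta> \<Longrightarrow> x \<in> X0"
    using X0 by (auto simp: open_dist)
  have PP: "P x u" if "dist x x0 < \<eta>" "norm u \<le> R" for x u
  proof -
    have "(x, u) \<in> W" using X0(3) \<eta>(2)[OF that(1)] that(2) by auto
    then have "(x, u) \<in> {z. P (fst z) (snd z)}" unfolding W_def using interior_subset by blast
    then show ?thesis by simp
  qed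
  define A where "A n = {\<omega> \<in> space M. \<eta> \<le> dist (X n \<omega>) x0}" for n
  define B where "B n = {\<omega> \<in> space M. R\<^sup>2 \<le> (norm (U n \<omega>))\<^sup>2}" for n
  have [measurable]: "A n \<in> events" "B n \<in> events" for n
    using X_events by (auto simp: A_def B_def)
  have B: "prob (B n) \<le> e / 2" for n
  proof -
    have "prob (B n) \<le> expectation (\<lambda>\<omega>. (norm (U n \<omega>))\<^sup>2) / R\<^sup>2"
      unfolding B_def using R(1) by (intro integral_Markov_inequality_measure[OF U_int, of "{}"]) auto
    also have "\<dots> \<le> (C + 1) / R\<^sup>2" using U_bound[of n] by (intro divide_right_mono) auto
    also have "\<dots> = e / 2" unfolding R(2) using C \<open>e > 0\<close> by (simp add: divide_simps)
    finally show ?thesis .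
  qed
  have "\<forall>\<^sub>F n in sequentially. prob (A n) < e / 2"
    using order_tendstoD(2)[OF X[OF \<eta>(1)], of "e / 2"] \<open>e > 0\<close> by (simp add: A_def)
  then show ?thesis
  proof eventually_elim
    case (elim n)
    have "prob (A n \<union> B n) \<le> e" using measure_Un_le[of "A n" M "B n"] elim B[of n] by simp
    moreover have "P (X n \<omega>) (U n \<omega>)" if "\<omega> \<in> space M - (A n \<union> B n)" for \<omega>
    proof (rule PP)
      show "dist (X n \<omega>) x0 < \<eta>" using that by (auto simp: A_def)
      have "(norm (U n \<omega>))\<^sup>2 < R\<^sup>2" using that by (auto simp: B_def)
      then show "norm (U n \<omega>) \<le> R" using R(1) by (meson less_imp_le power2_less_imp_less)
    qed
    ultimately show ?case by (intro bexI[of _ "A n \<union> B n"]) auto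
  qed
qed

text \<open>Weak convergence is tested on the piecewise linear step functions $h$. Their uniform continuity
allows to replace $D_n$ by $Q_n-Q_n^2$, and $h(q-q^2)$ is a continuous function of $e^{-q}\in[0,1]$.\<close>
lemma (in prob_space) weak_conv_from_quadratic_approximation:
  fixes D Q :: "nat \<Rightarrow> 'a \<Rightarrow> real" and Q' :: "'b \<Rightarrow> real"
  assumes N: "prob_space N"
    and D [measurable]: "\<And>n. D n \<in> borel_measurable M"
    and Q: "\<And>n. Q n \<in> borel_measurable M" "\<And>n \<omega>. 0 \<le> Q n \<omega>"
    and Q': "Q' \<in> borel_measurable N" "\<And>v. 0 \<le> Q' v"
    and laplace: "\<And>k::nat. (\<lambda>n. \<integral>\<omega>. exp (- (real k * Q n \<omega>)) \<partial>M) \<longlonglongrightarrow> (\<integral>v. exp (- (real k * Q' v)) \<partial>N)"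
    and close: "\<And>\<epsilon> e. \<epsilon> > 0 \<Longrightarrow> e > 0 \<Longrightarrow> \<forall>\<^sub>F n in sequentially. \<exists>G\<in>events. prob G \<le> e \<and>
      (\<forall>\<omega>\<in>space M - G. \<bar>D n \<omega> - (Q n \<omega> - (Q n \<omega>)\<^sup>2)\<bar> < \<epsilon>)"
  shows "weak_conv_m (\<lambda>n. distr M borel (D n)) (distr N borel (\<lambda>v. Q' v - (Q' v)\<^sup>2))"
proof (rule integral_cts_step_conv_imp_weak_conv)
  interpret N: prob_space N by fact
  note [measurable] = Q(1) Q'(1)
  show "real_distribution (distr M borel (D n))" for n by simp
  show "real_distribution (distr N borel (\<lambda>v. Q' v - (Q' v)\<^sup>2))" by simp
  fix a b :: real assume ab: "a < b"
  define h where "h = cts_step a b"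
  have h_cont: "continuous_on UNIV h" unfolding h_def by (rule continuous_on_cts_step[OF ab])
  then have [measurable]: "h \<in> borel_measurable borel" by (rule borel_measurable_continuous_onI)
  have h01: "0 \<le> h x" "h x \<le> 1" for x using ab by (auto simp: h_def cts_step_def)
  define g where "g r = (if r = 0 then 1 else h (- ln r - (ln r)\<^sup>2))" for r :: real
  have [measurable]: "g \<in> borel_measurable borel" unfolding g_def by measurable
  have "continuous_on {0..1} g"
    unfolding g_def h_def by (rule continuous_on_cts_step_of_log[OF ab])
  have g_exp: "g (exp (- q)) = h (q - q\<^sup>2)" for q by (simp add: g_def)
  have "(\<lambda>n. expectation (\<lambda>\<omega>. g (exp (- Q n \<omega>)))) \<longlonglongrightarrow> (\<integral>v. g (exp (- Q' v)) \<partial>N)"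
    by (intro expectation_tendsto_from_laplace[OF prob_space_axioms N Q Q' laplace]) fact+
  then have lim: "(\<lambda>n. expectation (\<lambda>\<omega>. h (Q n \<omega> - (Q n \<omega>)\<^sup>2))) \<longlonglongrightarrow> (\<integral>v. h (Q' v - (Q' v)\<^sup>2) \<partial>N)"
    by (simp only: g_exp)
  have "(\<lambda>n. expectation (\<lambda>\<omega>. h (D n \<omega>)) - expectation (\<lambda>\<omega>. h (Q n \<omega> - (Q n \<omega>)\<^sup>2))) \<longlonglongrightarrow> 0"
  proof (rule LIMSEQ_I)
    fix r :: real assume r: "0 < r"
    obtain d where d: "d > 0" "\<And>x y. \<bar>y - x\<bar> < d \<Longrightarrow> \<bar>h y - h x\<bar> < r / 3"
      using cts_step_uniformly_continuous[OF ab] r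
      unfolding uniformly_continuous_on_def h_def[symmetric] dist_real_def by (metis UNIV_I divide_pos_pos zero_less_numeral)
    have "\<forall>\<^sub>F n in sequentially. \<exists>G\<in>events. prob G \<le> r / 3 \<and>
      (\<forall>\<omega>\<in>space M - G. \<bar>D n \<omega> - (Q n \<omega> - (Q n \<omega>)\<^sup>2)\<bar> < d)"
      using close[of d "r / 3"] r d by simp
    then have "\<forall>\<^sub>F n in sequentially. norm (expectation (\<lambda>\<omega>. h (D n \<omega>)) - expectation (\<lambda>\<omega>. h (Q n \<omega> - (Q n \<omega>)\<^sup>2)) - 0) < r"
    proof eventually_elim
      case (elim n)
      then obtain G where G [measurable]: "G \<in> events" and pG: "prob G \<le> r / 3"
        and near: "\<And>\<omega>. \<omega> \<in> space M - G \<Longrightarrow> \<bar>D n \<omega> - (Q n \<omega> - (Q n \<omega>)\<^sup>2)\<bar> < d" by blast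
      have int: "integrable M (\<lambda>\<omega>. h (D n \<omega>))" "integrable M (\<lambda>\<omega>. h (Q n \<omega> - (Q n \<omega>)\<^sup>2))"
        using h01 by (auto intro!: integrable_const_bound[of _ 1])
      have "\<bar>expectation (\<lambda>\<omega>. h (D n \<omega>) - h (Q n \<omega> - (Q n \<omega>)\<^sup>2))\<bar> \<le> expectation (\<lambda>\<omega>. r / 3 + indicator G \<omega>)"
        unfolding real_norm_def[symmetric]
      proof (rule norm_integral_le_integral)
        fix \<omega> assume \<omega>: "\<omega> \<in> space M"
        show "norm (h (D n \<omega>) - h (Q n \<omega> - (Q n \<omega>)\<^sup>2)) \<le> r / 3 + indicator G \<omega>"
        proof (cases "\<omega> \<in> G")
          case True
          then show ?thesis using h01[of "D n \<omega>"] h01[of "Q n \<omega> - (Q n \<omega>)\<^sup>2"] r by (simp add: abs_le_iff)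
        next
          case False
          then show ?thesis using d(2)[OF near, of \<omega>] \<omega> by simp
        qed
      next
        show "integrable M (\<lambda>\<omega>. r / 3 + indicator G \<omega>)"
          by (rule integrable_const_bound[of _ "r / 3 + 1"]) (use r in \<open>auto simp: indicator_def\<close>)
      qed (use int in auto)
      also have "\<dots> = r / 3 + prob G"
      proof -
        have "integrable M (indicator G :: 'a \<Rightarrow> real)"
          by (rule integrable_const_bound[of _ 1]) auto
        then show ?thesis by (simp add: prob_space)
      qed
      finally show ?case using int pG r by simp
    qed
    then show "\<exists>n0. \<forall>n\<ge>n0. norm (expectation (\<lambda>\<omega>. h (D n \<omega>)) - expectation (\<lambda>\<omega>. h (Q n \<omega> - (Q n \<omega>)\<^sup>2)) - 0) < r"
      by (simp add: eventually_sequentially)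
  qed
  from tendsto_add[OF this lim] show "(\<lambda>n. integral\<^sup>L (distr M borel (D n)) (cts_step a b))
      \<longlonglongrightarrow> integral\<^sup>L (distr N borel (\<lambda>v. Q' v - (Q' v)\<^sup>2)) (cts_step a b)"
    by (simp add: integral_distr h_def[symmetric])
qed

section \<open>The score and Hotelling statistics as functions of one quadratic form\<close>

text \<open>The shift formula for second moments. With $d=0$ it links the sample covariance with the information
matrix, with $d=\delta/\sqrt n$ it links it with the Gram matrix of the centred vectors.\<close>
lemma sum_outer_deviations:
  fixes Z :: "nat \<Rightarrow> real ^ 'p"
  assumes "n \<ge> 1"
  shows "(\<Sum>i\<in>{1..n}. outer (Z i - sample_mean n Z) (Z i - sample_mean n Z))
    = (\<Sum>i\<in>{1..n}. outer (Z i - d) (Z i - d)) - real n *\<^sub>R outer (sample_mean n Z - d) (sample_mean n Z - d)"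
proof -
  define m where "m = sample_mean n Z"
  have m: "(\<Sum>i\<in>{1..n}. Z i $ j - d $ j) = real n * (m $ j - d $ j)" for j
    using assms by (simp add: m_def sample_mean_def sum_subtractf field_simps)
  have "(\<Sum>i\<in>{1..n}. (Z i $ j - m $ j) * (Z i $ k - m $ k))
    = (\<Sum>i\<in>{1..n}. (Z i $ j - d $ j) * (Z i $ k - d $ k)) - real n * ((m $ j - d $ j) * (m $ k - d $ k))" for j k
  proof -
    have "(\<Sum>i\<in>{1..n}. (Z i $ j - m $ j) * (Z i $ k - m $ k))
      = (\<Sum>i\<in>{1..n}. (Z i $ j - d $ j) * (Z i $ k - d $ k) - (m $ j - d $ j) * (Z i $ k - d $ k)
          - (Z i $ j - d $ j) * (m $ k - d $ k) + (m $ j - d $ j) * (m $ k - d $ k))"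
      by (intro sum.cong[OF refl]) (simp add: algebra_simps)
    also have "\<dots> = (\<Sum>i\<in>{1..n}. (Z i $ j - d $ j) * (Z i $ k - d $ k)) - (m $ j - d $ j) * (\<Sum>i\<in>{1..n}. Z i $ k - d $ k)
          - (\<Sum>i\<in>{1..n}. Z i $ j - d $ j) * (m $ k - d $ k) + real n * ((m $ j - d $ j) * (m $ k - d $ k))"
      by (simp only: sum.distrib sum_subtractf[of "\<lambda>i. (Z i $ j - d $ j) * (Z i $ k - d $ k) - (m $ j - d $ j) * (Z i $ k - d $ k)"]
          sum_subtractf[of "\<lambda>i. (Z i $ j - d $ j) * (Z i $ k - d $ k)"] sum_distrib_left[symmetric] sum_distrib_right[symmetric] sum_constant card_atLeastAtMost) simp
    finally show ?thesis unfolding m by (simp add: algebra_simps)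
  qed
  then show ?thesis
    by (simp add: vec_eq_iff outer_def m_def[symmetric])
qed

text \<open>The exact formula behind the theorem. With $q=u^\top A^{-1}u$ the Hotelling statistic is
$(1-\frac1n)q$, by scaling, and the score statistic is $q/(1+\frac qn)$, by the rank-one update.\<close>
lemma scaled_statistic_difference:
  fixes Z :: "nat \<Rightarrow> real ^ 'p"
  defines "A n \<equiv> (1 / real n) *\<^sub>R (\<Sum>i\<in>{1..n}. outer (Z i - sample_mean n Z) (Z i - sample_mean n Z))"
    and "u n \<equiv> sqrt (real n) *\<^sub>R sample_mean n Z"
  assumes n: "n \<ge> 2" and inv: "invertible (A n)" and nz: "1 + 1 / real n * inv_quad_form (A n) (u n) \<noteq> 0"
  shows "real n * (score_stat n Z - hotelling_stat n Z)
    = inv_quad_form (A n) (u n) * (1 - (1 - 1 / real n) * inv_quad_form (A n) (u n))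
      / (1 + 1 / real n * inv_quad_form (A n) (u n))"
proof -
  define q where "q = inv_quad_form (A n) (u n)"
  have mean: "sample_mean n Z = (1 / sqrt (real n)) *\<^sub>R u n" using n by (simp add: u_def)
  have cov: "sample_cov n Z = (real n / (real n - 1)) *\<^sub>R A n"
    using n by (simp add: sample_cov_def A_def divide_inverse)
  have "hotelling_stat n Z = real n * ((1 / sqrt (real n))\<^sup>2 / (real n / (real n - 1)) * q)"
    unfolding hotelling_stat_def cov mean q_def using n by (subst inv_quad_form_scale) auto
  also have "\<dots> = (1 - 1 / real n) * q" using n by (simp add: power_divide field_simps)
  finally have hot: "hotelling_stat n Z = (1 - 1 / real n) * q" .
  have "(\<Sum>i\<in>{1..n}. outer (Z i) (Z i)) = real n *\<^sub>R (A n + (1 / real n) *\<^sub>R outer (u n) (u n))"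
    using sum_outer_deviations[of n Z 0] n
    by (simp add: A_def u_def outer_scaleR scaleR_add_right)
  then have info: "information n Z 0 = (real n / 4) *\<^sub>R (A n + (1 / real n) *\<^sub>R outer (u n) (u n))"
    by (simp add: information_0)
  have sc: "score n Z 0 = (sqrt (real n) / 2) *\<^sub>R u n"
    by (simp add: score_0 u_def)
  have "score_stat n Z = (sqrt (real n) / 2)\<^sup>2 / (real n / 4) * inv_quad_form (A n + (1 / real n) *\<^sub>R outer (u n) (u n)) (u n)"
    unfolding score_stat_def info sc using n by (subst inv_quad_form_scale) auto
  also have "(sqrt (real n) / 2)\<^sup>2 / (real n / 4) = 1" using n by (simp add: power_divide)
  finally have score: "score_stat n Z = q / (1 + 1 / real n * q)"
    using inv_quad_form_rank_one_update[OF inv nz] by (simp add: q_def)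
  have "1 + 1 / real n * q \<noteq> 0" using nz by (simp add: q_def)
  then show ?thesis unfolding score hot q_def[symmetric] using n by (simp add: divide_simps) (simp add: algebra_simps)
qed

lemma tendsto_outer [tendsto_intros]:
  fixes x y :: "real ^ 'p"
  assumes "(f \<longlongrightarrow> x) F" "(g \<longlongrightarrow> y) F"
  shows "((\<lambda>z. outer (f z) (g z)) \<longlongrightarrow> outer x y) F"
  unfolding outer_def by (intro tendsto_vec_lambda tendsto_mult tendsto_vec_nth assms)

text \<open>Here $s$ stands for $1/n$, $C$ for the Gram matrix $\frac1n\sum_i W_iW_i^\top$ and $x$ for
$\sqrt n\,\bar Z$; then \<open>A s C x\<close> is the normalised matrix of squared deviations and \<open>F s q\<close> is
$n(\xi_{sc}-\xi_{hot})$. All expressions are continuous at $s=0$, $C=\Sigma$, where \<open>F\<close>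
becomes $q-q^2$. The first two conjuncts are the side conditions of \<open>scaled_statistic_difference\<close>,
the last one serves the unscaled difference of the statistics.\<close>
lemma eventually_statistic_difference_close:
  fixes \<Sigma> :: "real ^ 'p ^ 'p" and \<delta> u :: "real ^ 'p"
  assumes \<Sigma>: "pos_definite \<Sigma>" and "\<epsilon> > 0"
  defines "A s C x \<equiv> C - s *\<^sub>R outer (x - \<delta>) (x - \<delta>)"
  defines "F s q \<equiv> q * (1 - (1 - s) * q) / (1 + s * q)"
  shows "\<forall>\<^sub>F z in nhds ((0, \<Sigma>), u). (\<lambda>(s, C) x. invertible (A s C x) \<and> 1 + s * inv_quad_form (A s C x) x \<noteq> 0 \<and>
      \<bar>F s (inv_quad_form (A s C x) x) - (inv_quad_form \<Sigma> x - (inv_quad_form \<Sigma> x)\<^sup>2)\<bar> < \<epsilon> \<and>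
      \<bar>s * F s (inv_quad_form (A s C x) x)\<bar> < \<epsilon>) (fst z) (snd z)"
proof -
  let ?N = "nhds ((0 :: real, \<Sigma>), u)"
  have inv: "invertible \<Sigma>" by (rule pos_definite_invertible[OF \<Sigma>])
  define s C x where "s z = fst (fst z)" and "C z = snd (fst z)" and "x z = snd z" for z :: "(real \<times> (real ^ 'p ^ 'p)) \<times> (real ^ 'p)"
  have small: "\<forall>\<^sub>F z in ?N. \<bar>f z\<bar> < \<epsilon>" if "(f \<longlongrightarrow> c) ?N" "c = 0" for f c
    using tendstoD[OF that(1) \<open>\<epsilon> > 0\<close>] that(2) by (simp add: dist_real_def)
  have id: "((\<lambda>z. z) \<longlongrightarrow> ((0 :: real, \<Sigma>), u)) ?N" by (simp add: filterlim_ident)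
  have s: "(s \<longlongrightarrow> 0) ?N" and C: "(C \<longlongrightarrow> \<Sigma>) ?N" and x: "(x \<longlongrightarrow> u) ?N"
    using tendsto_fst[OF tendsto_fst[OF id]] tendsto_snd[OF tendsto_fst[OF id]] tendsto_snd[OF id]
    by (simp_all add: s_def[abs_def] C_def[abs_def] x_def[abs_def])
  have "((\<lambda>z. A (s z) (C z) (x z)) \<longlongrightarrow> \<Sigma> - 0 *\<^sub>R outer (u - \<delta>) (u - \<delta>)) ?N"
    unfolding A_def by (intro tendsto_intros s C x)
  then have A: "((\<lambda>z. A (s z) (C z) (x z)) \<longlongrightarrow> \<Sigma>) ?N" by simp
  define q where "q z = inv_quad_form (A (s z) (C z) (x z)) (x z)" for z
  define Q where "Q = inv_quad_form \<Sigma> u"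
  have q: "(q \<longlongrightarrow> Q) ?N"
    unfolding q_def[abs_def] Q_def by (rule tendsto_inv_quad_form[OF A x inv])
  have Q: "((\<lambda>z. inv_quad_form \<Sigma> (x z)) \<longlongrightarrow> Q) ?N"
    unfolding Q_def by (rule tendsto_inv_quad_form[OF tendsto_const x inv])
  have "((\<lambda>z. det (A (s z) (C z) (x z))) \<longlongrightarrow> det \<Sigma>) ?N"
    by (intro tendsto_det tendsto_vec_nth A)
  then have ev_inv: "\<forall>\<^sub>F z in ?N. det (A (s z) (C z) (x z)) \<noteq> 0"
    using inv by (intro tendsto_imp_eventually_ne[of _ "det \<Sigma>"]) (simp_all add: invertible_det_nz)
  have den: "((\<lambda>z. 1 + s z * q z) \<longlongrightarrow> 1 + 0 * Q) ?N" by (intro tendsto_intros s q)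
  then have ev_nz: "\<forall>\<^sub>F z in ?N. 1 + s z * q z \<noteq> 0"
    by (intro tendsto_imp_eventually_ne[of _ "1 + 0 * Q"]) simp_all
  have F: "((\<lambda>z. F (s z) (q z)) \<longlongrightarrow> Q * (1 - (1 - 0) * Q) / (1 + 0 * Q)) ?N"
    unfolding F_def by (intro tendsto_intros s q) simp
  have "((\<lambda>z. F (s z) (q z) - (inv_quad_form \<Sigma> (x z) - (inv_quad_form \<Sigma> (x z))\<^sup>2))
      \<longlongrightarrow> Q * (1 - (1 - 0) * Q) / (1 + 0 * Q) - (Q - Q\<^sup>2)) ?N"
    by (intro tendsto_intros F Q)
  moreover have "Q * (1 - (1 - 0) * Q) / (1 + 0 * Q) - (Q - Q\<^sup>2) = 0"
    by (simp add: power2_eq_square algebra_simps)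
  ultimately have ev_close: "\<forall>\<^sub>F z in ?N. \<bar>F (s z) (q z) - (inv_quad_form \<Sigma> (x z) - (inv_quad_form \<Sigma> (x z))\<^sup>2)\<bar> < \<epsilon>"
    by (rule small)
  have "((\<lambda>z. s z * F (s z) (q z)) \<longlongrightarrow> 0 * (Q * (1 - (1 - 0) * Q) / (1 + 0 * Q))) ?N"
    by (intro tendsto_mult s F)
  then have ev_small: "\<forall>\<^sub>F z in ?N. \<bar>s z * F (s z) (q z)\<bar> < \<epsilon>"
    by (rule small) simp
  from ev_inv ev_nz ev_close ev_small show ?thesis
    by eventually_elim (simp add: s_def C_def x_def q_def invertible_det_nz case_prod_beta)
qed

text \<open>With $y=\Sigma^{-1}(\delta+v)$ one has $(\Sigma-uu^\top)y=u-(u\cdot y)u$ for $u=\delta+v$.\<close>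
lemma limit_K_eq:
  fixes \<Sigma> :: "real ^ 'p ^ 'p"
  assumes "invertible \<Sigma>"
  shows "limit_K \<Sigma> \<delta> v = inv_quad_form \<Sigma> (\<delta> + v) - (inv_quad_form \<Sigma> (\<delta> + v))\<^sup>2"
proof -
  define u y where "u = \<delta> + v" and "y = matrix_inv \<Sigma> *v u"
  have "(\<Sigma> - outer u u) *v y = u - (u \<bullet> y) *\<^sub>R u"
    unfolding matrix_vector_mult_diff_rdistrib outer_mult_vector by (simp add: y_def matrix_inv_solves assms)
  then have "limit_K \<Sigma> \<delta> v = u \<bullet> (matrix_inv \<Sigma> *v (u - (u \<bullet> y) *\<^sub>R u))"
    by (simp add: limit_K_def Let_def u_def y_def)
  also have "\<dots> = u \<bullet> y - (u \<bullet> y)\<^sup>2"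
    by (simp add: matrix_vector_mult_diff_distrib matrix_vector_mult_scaleR y_def inner_diff_right power2_eq_square)
  finally show ?thesis using assms by (simp add: inv_quad_form_def u_def y_def)
qed

lemma borel_measurable_outer:
  fixes f :: "'a \<Rightarrow> real ^ 'p"
  assumes "f \<in> borel_measurable N"
  shows "(\<lambda>\<omega>. outer (f \<omega>) (f \<omega>)) \<in> borel_measurable N"
proof -
  have "continuous_on UNIV (\<lambda>x. outer x (x :: real ^ 'p))"
    unfolding outer_def by (intro continuous_intros)
  from measurable_compose[OF assms borel_measurable_continuous_onI[OF this]] show ?thesis .
qed

lemma norm_outer_self: "norm (outer x x) = (norm (x :: real ^ 'p))\<^sup>2"
proof -
  have "outer x x $ j = (x $ j) *\<^sub>R x" for j by (simp add: outer_def vec_eq_iff)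
  then have "norm (outer x x) = L2_set (\<lambda>j. \<bar>x $ j\<bar> * norm x) UNIV"
    unfolding norm_vec_def[of "outer x x"] by simp
  also have "\<dots> = norm x * norm x"
    by (subst L2_set_left_distrib[symmetric]) (simp_all add: norm_vec_def)
  finally show ?thesis by (simp add: power2_eq_square)
qed

lemma covariance_matrix_nth:
  fixes X :: "'a \<Rightarrow> real ^ 'p"
  assumes X: "(\<lambda>\<omega>. X \<omega> - integral\<^sup>L N X) \<in> borel_measurable N"
    and sq: "integrable N (\<lambda>\<omega>. (norm (X \<omega> - integral\<^sup>L N X))\<^sup>2)"
  shows "covariance_matrix N X $ j $ k
    = (\<integral>\<omega>. (X \<omega> - integral\<^sup>L N X) $ j * (X \<omega> - integral\<^sup>L N X) $ k \<partial>N)"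
proof -
  let ?Y = "\<lambda>\<omega>. X \<omega> - integral\<^sup>L N X"
  have "integrable N (\<lambda>\<omega>. outer (?Y \<omega>) (?Y \<omega>))"
    by (rule Bochner_Integration.integrable_bound[OF sq borel_measurable_outer[OF X]])
      (simp add: norm_outer_self)
  then have "(\<integral>\<omega>. outer (?Y \<omega>) (?Y \<omega>) $ j $ k \<partial>N) = (\<integral>\<omega>. outer (?Y \<omega>) (?Y \<omega>) \<partial>N) $ j $ k"
    by (intro integral_bounded_linear[of "\<lambda>B. B $ j $ k"]
        bounded_linear_compose[OF bounded_linear_vec_nth bounded_linear_vec_nth])
  then show ?thesis by (simp add: covariance_matrix_def outer_def)
qed

lemma norm_add_square_le: "(norm (x + y))\<^sup>2 \<le> 2 * (norm x)\<^sup>2 + 2 * (norm (y :: 'b::real_normed_vector))\<^sup>2"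
proof -
  have "(norm (x + y))\<^sup>2 \<le> (norm x + norm y)\<^sup>2" by (intro power_mono norm_triangle_ineq) simp
  moreover have "0 \<le> (norm x - norm y)\<^sup>2" by simp
  ultimately show ?thesis by (simp add: power2_sum power2_diff)
qed

lemma borel_measurable_nth:
  fixes f :: "'a \<Rightarrow> real ^ 'p"
  assumes [measurable]: "f \<in> borel_measurable N"
  shows "(\<lambda>\<omega>. f \<omega> $ j) \<in> borel_measurable N"
  unfolding cart_eq_inner_axis by measurable

lemma borel_measurable_statistics:
  fixes Z :: "nat \<Rightarrow> 'a \<Rightarrow> real ^ 'p"
  assumes Z: "\<And>i. 1 \<le> i \<Longrightarrow> i \<le> n \<Longrightarrow> Z i \<in> borel_measurable N"
  shows "(\<lambda>\<omega>. score_stat n (\<lambda>i. Z i \<omega>)) \<in> borel_measurable N"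
    and "(\<lambda>\<omega>. hotelling_stat n (\<lambda>i. Z i \<omega>)) \<in> borel_measurable N"
proof -
  have comp: "(\<lambda>\<omega>. Z i \<omega> $ j) \<in> borel_measurable N" if "i \<in> {1..n}" for i j
    using Z[of i] that by (intro borel_measurable_nth) auto
  have mean: "(\<lambda>\<omega>. sample_mean n (\<lambda>i. Z i \<omega>) $ j) \<in> borel_measurable N" for j
    unfolding sample_mean_def vector_scaleR_component sum_component
    by (intro borel_measurable_scaleR borel_measurable_times borel_measurable_const borel_measurable_sum comp)
  have info: "(\<lambda>\<omega>. information n (\<lambda>i. Z i \<omega>) 0 $ j $ k) \<in> borel_measurable N" for j k
    unfolding information_0 vector_scaleR_component sum_component outer_def vec_lambda_beta
    by (intro borel_measurable_scaleR borel_measurable_times borel_measurable_const borel_measurable_sum comp)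
  have sc: "(\<lambda>\<omega>. score n (\<lambda>i. Z i \<omega>) 0 $ j) \<in> borel_measurable N" for j
    unfolding score_0 vector_scaleR_component by (intro borel_measurable_scaleR borel_measurable_times borel_measurable_const mean)
  show "(\<lambda>\<omega>. score_stat n (\<lambda>i. Z i \<omega>)) \<in> borel_measurable N"
    unfolding score_stat_def by (intro borel_measurable_inv_quad_form info sc)
  have cov: "(\<lambda>\<omega>. sample_cov n (\<lambda>i. Z i \<omega>) $ j $ k) \<in> borel_measurable N" for j k
    unfolding sample_cov_def vector_scaleR_component sum_component outer_def vec_lambda_beta vector_minus_component
    by (intro borel_measurable_scaleR borel_measurable_times borel_measurable_const borel_measurable_sum borel_measurable_diff comp mean)
  show "(\<lambda>\<omega>. hotelling_stat n (\<lambda>i. Z i \<omega>)) \<in> borel_measurable N"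
    unfolding hotelling_stat_def
    by (intro borel_measurable_scaleR borel_measurable_times borel_measurable_const borel_measurable_inv_quad_form cov mean)
qed

section \<open>Arrays of centred i.i.d. vectors\<close>

lemma (in prob_space) integrable_if_norm_square_integrable:
  fixes X :: "'a \<Rightarrow> 'b::{banach, second_countable_topology}"
  assumes "X \<in> borel_measurable M" "integrable M (\<lambda>\<omega>. (norm (X \<omega>))\<^sup>2)"
  shows "integrable M X"
proof -
  have "integrable M (\<lambda>\<omega>. norm (X \<omega>))"
  proof (rule square_integrable_imp_integrable)
    show "(\<lambda>\<omega>. norm (X \<omega>)) \<in> borel_measurable M" using assms(1) by simp
  qed (rule assms(2))
  then show ?thesis by (rule integrable_norm_cancel[OF _ assms(1)])
qed

text \<open>The vectors $W_i^{(n)}$ of the theorem. Moments are stated for $W_1^{(1)}$ only, since all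
members have the same law.\<close>
locale centred_iid_array = prob_space M for M :: "'a measure" +
  fixes W :: "nat \<Rightarrow> nat \<Rightarrow> 'a \<Rightarrow> real ^ 'p" and \<Sigma> :: "real ^ 'p ^ 'p"
  assumes indep: "indep_vars (\<lambda>_. borel) (\<lambda>(n, i). W n i) {(n, i). 1 \<le> i \<and> i \<le> n}"
    and ident: "\<And>n i. 1 \<le> i \<Longrightarrow> i \<le> n \<Longrightarrow> distr M borel (W n i) = distr M borel (W 1 1)"
    and square_integrable: "integrable M (\<lambda>\<omega>. (norm (W 1 1 \<omega>))\<^sup>2)"
    and mean_zero: "expectation (W 1 1) = 0"
    and second_moment: "\<And>j k. expectation (\<lambda>\<omega>. W 1 1 \<omega> $ j * W 1 1 \<omega> $ k) = \<Sigma> $ j $ k"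
begin

text \<open>Keeps the index of the reference vector \<open>W 1 1\<close> in the form in which the lemmas mention it.\<close>
declare One_nat_def [simp del]

lemma W_measurable: "1 \<le> i \<Longrightarrow> i \<le> n \<Longrightarrow> W n i \<in> borel_measurable M"
  using indep by (auto simp: indep_vars_def2)

lemma W_1_1_measurable [measurable]: "W 1 1 \<in> borel_measurable M"
  by (rule W_measurable) auto

lemma indep_transform:
  assumes h: "h \<in> borel_measurable borel"
  shows "indep_vars (\<lambda>_. borel) (\<lambda>(n, i) \<omega>. h (W n i \<omega>)) {(n, i). 1 \<le> i \<and> i \<le> n}"
  using indep_vars_compose2[OF indep, of "\<lambda>_. h" "\<lambda>_. borel"] h by (simp add: case_prod_beta')

lemma indep_row_transform:
  assumes h: "h \<in> borel_measurable borel"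
  shows "indep_vars (\<lambda>_. borel) (\<lambda>i \<omega>. h (W n i \<omega>)) {1..n}"
proof -
  have sub: "Pair n ` {1..n} \<subseteq> {(n, i). 1 \<le> i \<and> i \<le> n}" by auto
  show ?thesis
    using indep_vars_reindex[OF _ indep_vars_subset[OF indep_transform[OF h] sub]] by (simp add: inj_on_def)
qed

lemma ident_transform:
  assumes [measurable]: "h \<in> borel_measurable borel" and ni: "1 \<le> i" "i \<le> n"
  shows "distr M borel (\<lambda>\<omega>. h (W n i \<omega>)) = distr M borel (\<lambda>\<omega>. h (W 1 1 \<omega>))"
proof -
  have [measurable]: "W n i \<in> borel_measurable M" by (rule W_measurable[OF ni])
  have "distr M borel (\<lambda>\<omega>. h (W n i \<omega>)) = distr (distr M borel (W n i)) borel h"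
    by (simp add: distr_distr comp_def)
  also have "\<dots> = distr M borel (\<lambda>\<omega>. h (W 1 1 \<omega>))"
    unfolding ident[OF ni] by (simp add: distr_distr comp_def)
  finally show ?thesis .
qed

lemma integral_transform:
  assumes h [measurable]: "h \<in> borel_measurable borel" and ni: "1 \<le> i" "i \<le> n"
  shows "integrable M (\<lambda>\<omega>. h (W n i \<omega>)) \<longleftrightarrow> integrable M (\<lambda>\<omega>. h (W 1 1 \<omega>) :: real)"
    and "expectation (\<lambda>\<omega>. h (W n i \<omega>)) = expectation (\<lambda>\<omega>. h (W 1 1 \<omega>))"
proof -
  have [measurable]: "W n i \<in> borel_measurable M" by (rule W_measurable[OF ni])
  have 1: "integrable M (\<lambda>\<omega>. h (W m k \<omega>)) \<longleftrightarrow> integrable (distr M borel (W m k)) h"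
    "expectation (\<lambda>\<omega>. h (W m k \<omega>)) = integral\<^sup>L (distr M borel (W m k)) h"
    if "W m k \<in> borel_measurable M" for m k
    using that by (simp_all add: integrable_distr_eq integral_distr)
  show "integrable M (\<lambda>\<omega>. h (W n i \<omega>)) \<longleftrightarrow> integrable M (\<lambda>\<omega>. h (W 1 1 \<omega>))"
    "expectation (\<lambda>\<omega>. h (W n i \<omega>)) = expectation (\<lambda>\<omega>. h (W 1 1 \<omega>))"
    by (simp_all only: 1[OF W_measurable[OF ni]] 1[OF W_1_1_measurable] ident[OF ni])
qed

lemma integrable_products:
  "integrable M (\<lambda>\<omega>. W 1 1 \<omega> $ j * W 1 1 \<omega> $ k)"
proof (rule Bochner_Integration.integrable_bound[OF square_integrable])
  show "(\<lambda>\<omega>. W 1 1 \<omega> $ j * W 1 1 \<omega> $ k) \<in> borel_measurable M"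
    by (intro borel_measurable_times borel_measurable_nth W_1_1_measurable)
  have "\<bar>x $ j * x $ k\<bar> \<le> (norm x)\<^sup>2" for x :: "real ^ 'p"
    unfolding abs_mult power2_eq_square by (intro mult_mono component_le_norm_cart) auto
  then show "AE \<omega> in M. norm (W 1 1 \<omega> $ j * W 1 1 \<omega> $ k) \<le> norm ((norm (W 1 1 \<omega>))\<^sup>2)" by simp
qed

lemma integrable_W: "integrable M (W 1 1)"
  by (rule integrable_if_norm_square_integrable[OF W_1_1_measurable square_integrable])

lemma inner_moments:
  shows "expectation (\<lambda>\<omega>. t \<bullet> W 1 1 \<omega>) = 0"
    and "integrable M (\<lambda>\<omega>. (t \<bullet> W 1 1 \<omega>)\<^sup>2)"
    and "expectation (\<lambda>\<omega>. (t \<bullet> W 1 1 \<omega>)\<^sup>2) = t \<bullet> (\<Sigma> *v t)"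
proof -
  show "expectation (\<lambda>\<omega>. t \<bullet> W 1 1 \<omega>) = 0"
    using integrable_W by (simp add: integral_inner_right mean_zero)
  have eq: "(t \<bullet> x)\<^sup>2 = (\<Sum>j\<in>UNIV. \<Sum>k\<in>UNIV. t $ j * t $ k * (x $ j * x $ k))" for x
    by (simp add: inner_vec_def power2_eq_square sum_product mult_ac)
  show "integrable M (\<lambda>\<omega>. (t \<bullet> W 1 1 \<omega>)\<^sup>2)"
    unfolding eq by (intro Bochner_Integration.integrable_sum integrable_mult_right integrable_products)
  show "expectation (\<lambda>\<omega>. (t \<bullet> W 1 1 \<omega>)\<^sup>2) = t \<bullet> (\<Sigma> *v t)"
    unfolding eq using integrable_products
    by (simp add: Bochner_Integration.integral_sum second_moment inner_vec_def matrix_vector_mult_def sum_distrib_left mult_ac)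
qed

text \<open>The weak law applies to each entry. Carrying the deterministic coordinate $1/n$ along makes the pair
a single random point that tends to $(0,\Sigma)$, as needed for the tube argument.\<close>
lemma gram_matrix_tendsto:
  assumes "\<eta> > 0"
  shows "(\<lambda>n. prob {\<omega> \<in> space M. \<eta> \<le> dist (1 / real n, (1 / real n) *\<^sub>R (\<Sum>i=1..n. outer (W n i \<omega>) (W n i \<omega>))) (0, \<Sigma>)}) \<longlonglongrightarrow> 0"
    (is "(\<lambda>n. prob {\<omega> \<in> space M. \<eta> \<le> ?d n \<omega>}) \<longlonglongrightarrow> 0")
proof -
  define E where "E n j k \<omega> = \<bar>(\<Sum>i=1..n. W n i \<omega> $ j * W n i \<omega> $ k) / real n - \<Sigma> $ j $ k\<bar>" for n j k \<omega>
  define Y where "Y n \<omega> = 1 / real n + (\<Sum>j\<in>UNIV. \<Sum>k\<in>UNIV. E n j k \<omega>)" for n \<omega>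
  have h: "(\<lambda>x::real ^ 'p. x $ j * x $ k) \<in> borel_measurable borel" for j k
    by (intro borel_measurable_times borel_measurable_nth) simp_all
  have int_E: "integrable M (E n j k)" for n j k
  proof -
    have "integrable M (\<lambda>\<omega>. W n i \<omega> $ j * W n i \<omega> $ k)" if "i \<in> {1..n}" for i
      using integral_transform(1)[OF h[of j k], of i n] integrable_products[of j k] that by simp
    then show ?thesis unfolding E_def[abs_def]
      by (intro integrable_abs Bochner_Integration.integrable_diff integrable_divide_zero impI
          Bochner_Integration.integrable_sum integrable_const)
  qed
  then have int_Y: "integrable M (Y n)" for n
    unfolding Y_def[abs_def] by (intro Bochner_Integration.integrable_add Bochner_Integration.integrable_sum integrable_const)
  have EE: "(\<lambda>n. expectation (E n j k)) \<longlonglongrightarrow> 0" for j k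
  proof -
    let ?\<mu> = "distr M borel (\<lambda>\<omega>. W 1 1 \<omega> $ j * W 1 1 \<omega> $ k)"
    have m: "(\<lambda>\<omega>. W 1 1 \<omega> $ j * W 1 1 \<omega> $ k) \<in> borel_measurable M"
      by (rule borel_measurable_integrable[OF integrable_products])
    have "integral\<^sup>L ?\<mu> (\<lambda>x. x) = \<Sigma> $ j $ k"
      using m by (simp add: integral_distr second_moment)
    moreover have "integrable ?\<mu> (\<lambda>x. x)" using m by (simp add: integrable_distr_eq integrable_products)
    moreover have "(\<lambda>n. expectation (\<lambda>\<omega>. \<bar>(\<Sum>i=1..n. W n i \<omega> $ j * W n i \<omega> $ k) / real n - integral\<^sup>L ?\<mu> (\<lambda>x. x)\<bar>)) \<longlonglongrightarrow> 0"
      if "integrable ?\<mu> (\<lambda>x. x)"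
      by (rule weak_law_identical_rows[OF indep_row_transform[OF h] ident_transform[OF h] that]) auto
    ultimately show ?thesis by (simp add: E_def[abs_def])
  qed
  have EY: "(\<lambda>n. expectation (Y n)) \<longlonglongrightarrow> 0"
  proof -
    have "expectation (Y n) = 1 / real n + (\<Sum>j\<in>UNIV. \<Sum>k\<in>UNIV. expectation (E n j k))" for n
      unfolding Y_def[abs_def] using int_E by (simp add: prob_space Bochner_Integration.integral_sum)
    moreover have "(\<lambda>n. 1 / real n + (\<Sum>j\<in>UNIV. \<Sum>k\<in>UNIV. expectation (E n j k)))
      \<longlonglongrightarrow> 0 + (\<Sum>j\<in>(UNIV :: 'p set). \<Sum>k\<in>(UNIV :: 'p set). 0)"
      by (intro tendsto_add tendsto_sum EE lim_1_over_n)
    ultimately show ?thesis by simp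
  qed
  have dist_le: "?d n \<omega> \<le> Y n \<omega>" for n \<omega>
  proof -
    have norm_le: "norm B \<le> (\<Sum>j\<in>UNIV. \<Sum>k\<in>UNIV. \<bar>B $ j $ k\<bar>)" for B :: "real ^ 'p ^ 'p"
    proof -
      have "norm B \<le> (\<Sum>j\<in>UNIV. norm (B $ j))" unfolding norm_vec_def by (rule L2_set_le_sum) simp
      also have "\<dots> \<le> (\<Sum>j\<in>UNIV. \<Sum>k\<in>UNIV. \<bar>B $ j $ k\<bar>)" by (intro sum_mono norm_le_l1_cart)
      finally show ?thesis .
    qed
    define B where "B = (1 / real n) *\<^sub>R (\<Sum>i=1..n. outer (W n i \<omega>) (W n i \<omega>))"
    have "dist (1 / real n, B) (0, \<Sigma>) \<le> 1 / real n + norm (B - \<Sigma>)"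
      unfolding dist_Pair_Pair using sqrt_sum_squares_le_sum[of "1 / real n" "norm (B - \<Sigma>)"]
      by (simp add: dist_norm)
    also have "norm (B - \<Sigma>) \<le> (\<Sum>j\<in>UNIV. \<Sum>k\<in>UNIV. E n j k \<omega>)"
      using norm_le[of "B - \<Sigma>"] by (simp add: E_def B_def outer_def)
    finally show ?thesis by (simp add: Y_def B_def)
  qed
  show ?thesis
  proof (rule tendsto_sandwich[OF _ _ tendsto_const])
    show "\<forall>\<^sub>F n in sequentially. 0 \<le> prob {\<omega> \<in> space M. \<eta> \<le> ?d n \<omega>}" by simp
    show "\<forall>\<^sub>F n in sequentially. prob {\<omega> \<in> space M. \<eta> \<le> ?d n \<omega>} \<le> expectation (Y n) / \<eta>"
    proof (intro always_eventually allI)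
      fix n
      have Y0: "0 \<le> Y n \<omega>" for \<omega> by (auto simp: Y_def E_def intro!: add_nonneg_nonneg sum_nonneg)
      have "prob {\<omega> \<in> space M. \<eta> \<le> ?d n \<omega>} \<le> prob {\<omega> \<in> space M. \<eta> \<le> Y n \<omega>}"
        using borel_measurable_integrable[OF int_Y[of n]] dist_le[of n]
        by (intro finite_measure_mono) (auto intro: order_trans)
      also have "\<dots> \<le> expectation (Y n) / \<eta>"
        using Y0 \<open>\<eta> > 0\<close> by (intro integral_Markov_inequality_measure[OF int_Y, of "{}"]) auto
      finally show "prob {\<omega> \<in> space M. \<eta> \<le> ?d n \<omega>} \<le> expectation (Y n) / \<eta>" .
    qed
    show "(\<lambda>n. expectation (Y n) / \<eta>) \<longlonglongrightarrow> 0" using tendsto_divide[OF EY tendsto_const, of \<eta>] \<open>\<eta> > 0\<close> by simp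
  qed
qed

lemma gram_matrix_events:
  "{\<omega> \<in> space M. \<eta> \<le> dist (1 / real n, (1 / real n) *\<^sub>R (\<Sum>i=1..n. outer (W n i \<omega>) (W n i \<omega>))) (0, \<Sigma>)} \<in> events"
proof -
  have [measurable]: "(\<lambda>\<omega>. \<Sum>i=1..n. outer (W n i \<omega>) (W n i \<omega>)) \<in> borel_measurable M"
    by (intro borel_measurable_sum borel_measurable_outer W_measurable) auto
  show ?thesis unfolding dist_Pair_Pair by measurable
qed

text \<open>Tightness of $u=\delta+n^{-1/2}\sum_i W_i$: each coordinate of the sum has second moment $n$ times that
of a single summand. For $n=0$ division by zero gives $u=\delta$, so the bound holds for every $n$.\<close>
lemma normalised_sum_square_bound:
  fixes \<delta> :: "real ^ 'p"
  defines "U n \<omega> \<equiv> \<delta> + (1 / sqrt (real n)) *\<^sub>R (\<Sum>i=1..n. W n i \<omega>)"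
  shows "integrable M (\<lambda>\<omega>. (norm (U n \<omega>))\<^sup>2)"
    and "expectation (\<lambda>\<omega>. (norm (U n \<omega>))\<^sup>2) \<le> 2 * (norm \<delta>)\<^sup>2 + 2 * (\<Sum>b\<in>Basis. b \<bullet> (\<Sigma> *v b))"
proof -
  define S where "S b \<omega> = (\<Sum>i=1..n. b \<bullet> W n i \<omega>)" for b \<omega>
  have h: "(\<lambda>x::real ^ 'p. b \<bullet> x) \<in> borel_measurable borel" "(\<lambda>x::real ^ 'p. (b \<bullet> x)\<^sup>2) \<in> borel_measurable borel" for b
    by measurable
  have sq: "integrable M (\<lambda>\<omega>. (b \<bullet> W n i \<omega>)\<^sup>2)" if "i \<in> {1..n}" for i b
    using integral_transform(1)[OF h(2), of i n] inner_moments(2) that by simp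
  have z: "expectation (\<lambda>\<omega>. b \<bullet> W n i \<omega>) = 0" if "i \<in> {1..n}" for i b
    using integral_transform(2)[OF h(1), of i n] inner_moments(1) that by simp
  have v: "expectation (\<lambda>\<omega>. (b \<bullet> W n i \<omega>)\<^sup>2) = b \<bullet> (\<Sigma> *v b)" if "i \<in> {1..n}" for i b
    using integral_transform(2)[OF h(2), of i n] inner_moments(3) that by simp
  have int_S: "integrable M (\<lambda>\<omega>. (S b \<omega>)\<^sup>2)" for b
    unfolding S_def by (rule integrable_square_sum_indep[OF _ indep_row_transform[OF h(1)] sq z]) auto
  have ES: "expectation (\<lambda>\<omega>. (S b \<omega>)\<^sup>2) = real n * (b \<bullet> (\<Sigma> *v b))" for b
    unfolding S_def by (subst expectation_square_sum_indep[OF _ indep_row_transform[OF h(1)] sq z]) (auto simp: v)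
  have diag: "0 \<le> b \<bullet> (\<Sigma> *v b)" for b
    unfolding inner_moments(3)[symmetric] by simp
  have meas: "U n \<in> borel_measurable M"
    unfolding U_def[abs_def] using W_measurable
    by (intro borel_measurable_add borel_measurable_const borel_measurable_scaleR borel_measurable_sum) auto
  have bound: "(norm (U n \<omega>))\<^sup>2 \<le> 2 * (norm \<delta>)\<^sup>2 + 2 * (\<Sum>b\<in>Basis. (S b \<omega>)\<^sup>2 / real n)" for \<omega>
  proof -
    define X where "X = (1 / sqrt (real n)) *\<^sub>R (\<Sum>i=1..n. W n i \<omega>)"
    have "(norm (\<delta> + X))\<^sup>2 \<le> 2 * (norm \<delta>)\<^sup>2 + 2 * (norm X)\<^sup>2" by (rule norm_add_square_le)
    moreover have "(norm X)\<^sup>2 = (\<Sum>b\<in>Basis. (X \<bullet> b)\<^sup>2)"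
      unfolding power2_norm_eq_inner by (subst euclidean_inner) (simp add: power2_eq_square)
    moreover have "(X \<bullet> b)\<^sup>2 = (S b \<omega>)\<^sup>2 / real n" for b
      by (simp add: X_def S_def inner_commute[of _ b] inner_sum_right power_mult_distrib power_divide)
    ultimately show ?thesis by (simp add: U_def X_def)
  qed
  have int_B: "integrable M (\<lambda>\<omega>. 2 * (norm \<delta>)\<^sup>2 + 2 * (\<Sum>b\<in>Basis. (S b \<omega>)\<^sup>2 / real n))"
    using int_S by (intro Bochner_Integration.integrable_add integrable_const integrable_mult_right
        Bochner_Integration.integrable_sum integrable_divide_zero impI)
  show int_U: "integrable M (\<lambda>\<omega>. (norm (U n \<omega>))\<^sup>2)"
    by (rule Bochner_Integration.integrable_bound[OF int_B]) (use meas in \<open>auto intro: order_trans[OF bound abs_ge_self]\<close>)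
  have "expectation (\<lambda>\<omega>. (norm (U n \<omega>))\<^sup>2) \<le> expectation (\<lambda>\<omega>. 2 * (norm \<delta>)\<^sup>2 + 2 * (\<Sum>b\<in>Basis. (S b \<omega>)\<^sup>2 / real n))"
    by (intro integral_mono int_U int_B bound)
  also have "\<dots> = 2 * (norm \<delta>)\<^sup>2 + 2 * (\<Sum>b\<in>Basis. real n * (b \<bullet> (\<Sigma> *v b)) / real n)"
    using int_S by (simp add: prob_space Bochner_Integration.integral_sum ES)
  also have "\<dots> \<le> 2 * (norm \<delta>)\<^sup>2 + 2 * (\<Sum>b\<in>Basis. b \<bullet> (\<Sigma> *v b))"
    using diag by (intro add_left_mono mult_left_mono sum_mono) auto
  finally show "expectation (\<lambda>\<omega>. (norm (U n \<omega>))\<^sup>2) \<le> 2 * (norm \<delta>)\<^sup>2 + 2 * (\<Sum>b\<in>Basis. b \<bullet> (\<Sigma> *v b))" .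
qed

text \<open>The Cramer--Wold device: for fixed $t\neq0$ the linear forms $t\cdot W_i$ have variance
$t\cdot\Sigma t>0$, and the one-dimensional central limit theorem applies to them.\<close>
lemma characteristic_function_normalised_sum:
  fixes \<delta> :: "real ^ 'p"
  assumes \<Sigma>: "pos_definite \<Sigma>"
  defines "U n \<omega> \<equiv> \<delta> + (1 / sqrt (real n)) *\<^sub>R (\<Sum>i=1..n. W n i \<omega>)"
  shows "(\<lambda>n. CLINT \<omega>|M. iexp (t \<bullet> U n \<omega>)) \<longlonglongrightarrow> (CLINT v|gaussian \<Sigma>. iexp (t \<bullet> (\<delta> + v)))"
proof -
  have h [measurable]: "(\<lambda>x::real ^ 'p. t \<bullet> x) \<in> borel_measurable borel" by measurable
  have "(\<lambda>n. CLINT \<omega>|M. iexp ((\<Sum>i=1..n. t \<bullet> W n i \<omega>) / sqrt (real n))) \<longlonglongrightarrow> exp (- (t \<bullet> (\<Sigma> *v t)) / 2)"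
  proof (cases "t = 0")
    case True then show ?thesis by (simp add: prob_space)
  next
    case False
    then have pos: "0 < t \<bullet> (\<Sigma> *v t)" using \<Sigma> by (simp add: pos_definite_def)
    let ?\<mu> = "distr M borel (\<lambda>\<omega>. t \<bullet> W 1 1 \<omega>)"
    have "(\<lambda>n. CLINT \<omega>|M. iexp ((\<Sum>i=1..n. t \<bullet> W n i \<omega>) / sqrt (real n)))
      \<longlonglongrightarrow> exp (- (sqrt (t \<bullet> (\<Sigma> *v t)))\<^sup>2 / 2)"
      using pos inner_moments[of t]
      by (intro characteristic_function_clt_rows[OF indep_transform[OF h] ident_transform[OF h]])
        (simp_all add: integral_distr integrable_distr_eq)
    then show ?thesis using pos by simp
  qed
  from tendsto_mult[OF tendsto_const[of "iexp (t \<bullet> \<delta>)"] this]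
  have "(\<lambda>n. iexp (t \<bullet> \<delta>) * (CLINT \<omega>|M. iexp ((\<Sum>i=1..n. t \<bullet> W n i \<omega>) / sqrt (real n))))
    \<longlonglongrightarrow> iexp (t \<bullet> \<delta>) * (CLINT v|gaussian \<Sigma>. iexp (t \<bullet> v))"
    by (simp add: gaussian_characteristic_function[OF \<Sigma>])
  moreover have "iexp (t \<bullet> \<delta>) * (CLINT \<omega>|M. iexp ((\<Sum>i=1..n. t \<bullet> W n i \<omega>) / sqrt (real n)))
    = (CLINT \<omega>|M. iexp (t \<bullet> U n \<omega>))" for n
    by (simp add: U_def inner_add_right inner_sum_right distrib_left exp_add)
  moreover have "iexp (t \<bullet> \<delta>) * (CLINT v|gaussian \<Sigma>. iexp (t \<bullet> v)) = (CLINT v|gaussian \<Sigma>. iexp (t \<bullet> (\<delta> + v)))"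
    by (simp add: inner_add_right distrib_left exp_add)
  ultimately show ?thesis by simp
qed

end

section \<open>Asymptotic equivalence of the two tests\<close>

theorem theorem1:
  fixes M :: "'a measure"
    and \<delta> :: "real ^ 'p"
    and \<Sigma> :: "real ^ 'p ^ 'p"
    and Z :: "nat \<Rightarrow> nat \<Rightarrow> 'a \<Rightarrow> real ^ 'p"
  assumes "prob_space M"
    and "pos_definite \<Sigma>"
    and Z_measurable: "\<And>n i. 1 \<le> i \<Longrightarrow> i \<le> n \<Longrightarrow> Z n i \<in> borel_measurable M"
    and Z_square_integrable:
      "\<And>n i. 1 \<le> i \<Longrightarrow> i \<le> n \<Longrightarrow> integrable M (\<lambda>\<omega>. (norm (Z n i \<omega>))\<^sup>2)"
    and Z_mean:
      "\<And>n i. 1 \<le> i \<Longrightarrow> i \<le> n \<Longrightarrow> integral\<^sup>L M (Z n i) = \<delta> /\<^sub>R sqrt (real n)"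
    and Z_cov:
      "\<And>n i. 1 \<le> i \<Longrightarrow> i \<le> n \<Longrightarrow> covariance_matrix M (Z n i) = \<Sigma>"
    and W_indep:
      "prob_space.indep_vars M (\<lambda>_. borel) (\<lambda>(n, i) \<omega>. Z n i \<omega> - \<delta> /\<^sub>R sqrt (real n))
         {(n, i). 1 \<le> i \<and> i \<le> n}"
    and W_ident:
      "\<And>n i m j. 1 \<le> i \<Longrightarrow> i \<le> n \<Longrightarrow> 1 \<le> j \<Longrightarrow> j \<le> m \<Longrightarrow>
         distr M borel (\<lambda>\<omega>. Z n i \<omega> - \<delta> /\<^sub>R sqrt (real n)) =
         distr M borel (\<lambda>\<omega>. Z m j \<omega> - \<delta> /\<^sub>R sqrt (real m))"
  shows "(\<forall>\<epsilon>>0. (\<lambda>n. measure M {\<omega> \<in> space M.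
        \<epsilon> < \<bar>score_stat n (\<lambda>i. Z n i \<omega>) - hotelling_stat n (\<lambda>i. Z n i \<omega>)\<bar>}) \<longlonglongrightarrow> 0) \<and>
    weak_conv_m (\<lambda>n. distr M borel (\<lambda>\<omega>.
        real n * (score_stat n (\<lambda>i. Z n i \<omega>) - hotelling_stat n (\<lambda>i. Z n i \<omega>))))
      (distr (gaussian \<Sigma>) borel (limit_K \<Sigma> \<delta>))"
proof -
  interpret prob_space M by fact
  note One_nat_def [simp del]
  note \<Sigma> = \<open>pos_definite \<Sigma>\<close>
  have inv: "invertible \<Sigma>" by (rule pos_definite_invertible[OF \<Sigma>])
  define W where "W n i \<omega> = Z n i \<omega> - \<delta> /\<^sub>R sqrt (real n)" for n i \<omega>
  have one: "1 \<le> (1::nat)" by simp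
  have [measurable]: "Z 1 1 \<in> borel_measurable M" by (rule Z_measurable[OF one one])
  have int_Z: "integrable M (Z 1 1)"
    by (rule integrable_if_norm_square_integrable[OF Z_measurable Z_square_integrable]) simp_all
  have W11: "W 1 1 \<omega> = Z 1 1 \<omega> - integral\<^sup>L M (Z 1 1)" for \<omega>
    using Z_mean[OF one one] by (simp add: W_def)
  have sq_W: "integrable M (\<lambda>\<omega>. (norm (W 1 1 \<omega>))\<^sup>2)"
  proof (rule Bochner_Integration.integrable_bound[of _ "\<lambda>\<omega>. 2 * (norm (Z 1 1 \<omega>))\<^sup>2 + 2 * (norm (integral\<^sup>L M (Z 1 1)))\<^sup>2"])
    have "(norm (x - y))\<^sup>2 \<le> 2 * (norm x)\<^sup>2 + 2 * (norm y)\<^sup>2" for x y :: "real ^ 'p"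
      using norm_add_square_le[of x "- y"] by simp
    then show "AE \<omega> in M. norm ((norm (W 1 1 \<omega>))\<^sup>2) \<le> norm (2 * (norm (Z 1 1 \<omega>))\<^sup>2 + 2 * (norm (integral\<^sup>L M (Z 1 1)))\<^sup>2)"
      by (auto simp: W11 intro: order_trans)
    show "(\<lambda>\<omega>. (norm (W 1 1 \<omega>))\<^sup>2) \<in> borel_measurable M" unfolding W11 by measurable
    show "integrable M (\<lambda>\<omega>. 2 * (norm (Z 1 1 \<omega>))\<^sup>2 + 2 * (norm (integral\<^sup>L M (Z 1 1)))\<^sup>2)"
      using Z_square_integrable[OF one one] by simp
  qed
  have mean_W: "expectation (W 1 1) = 0"
    unfolding W11[abs_def] using int_Z by (simp add: prob_space)
  have moment_W: "expectation (\<lambda>\<omega>. W 1 1 \<omega> $ j * W 1 1 \<omega> $ k) = \<Sigma> $ j $ k" for j k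
  proof -
    have "W 1 1 \<in> borel_measurable M" unfolding W11[abs_def] by measurable
    then show ?thesis
      using covariance_matrix_nth[of "Z 1 1" M j k] sq_W Z_cov[OF one one]
      unfolding W11[abs_def] by simp
  qed
  interpret centred_iid_array M W \<Sigma>
  proof
    show "indep_vars (\<lambda>_. borel) (\<lambda>(n, i). W n i) {(n, i). 1 \<le> i \<and> i \<le> n}"
      using W_indep by (simp add: W_def[abs_def] case_prod_beta')
    show "distr M borel (W n i) = distr M borel (W 1 1)" if "1 \<le> i" "i \<le> n" for n i
      unfolding W_def[abs_def] using W_ident[OF that one one] .
  qed (fact sq_W mean_W moment_W)+
  \<comment> \<open>\<open>U\<close> is $\sqrt n\,\bar Z$, \<open>X\<close> collects $1/n$ and the Gram matrix, \<open>q\<close> is $Q_n$.\<close>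
  define U where "U n \<omega> = \<delta> + (1 / sqrt (real n)) *\<^sub>R (\<Sum>i=1..n. W n i \<omega>)" for n \<omega>
  define X where "X n \<omega> = (1 / real n, (1 / real n) *\<^sub>R (\<Sum>i=1..n. outer (W n i \<omega>) (W n i \<omega>)))" for n \<omega>
  define q where "q n \<omega> = inv_quad_form \<Sigma> (U n \<omega>)" for n \<omega>
  define D where "D n \<omega> = real n * (score_stat n (\<lambda>i. Z n i \<omega>) - hotelling_stat n (\<lambda>i. Z n i \<omega>))" for n \<omega>
  have U_meas [measurable]: "U n \<in> borel_measurable M" for n
    unfolding U_def[abs_def] using W_measurable
    by (intro borel_measurable_add borel_measurable_const borel_measurable_scaleR borel_measurable_sum) auto
  have q_eq: "inv_quad_form \<Sigma> x = x \<bullet> (matrix_inv \<Sigma> *v x)" for x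
    using inv by (simp add: inv_quad_form_def)
  have q_nonneg: "0 \<le> inv_quad_form \<Sigma> x" for x
    unfolding q_eq using pos_definite_matrix_inv[OF \<Sigma>] by (cases "x = 0") (auto simp: pos_definite_def less_imp_le)
  have q_meas: "(\<lambda>\<omega>. inv_quad_form \<Sigma> (Y \<omega>)) \<in> borel_measurable N" if [measurable]: "Y \<in> borel_measurable N" for Y and N :: "'c measure"
    unfolding q_eq by measurable
  have stat_meas: "(\<lambda>\<omega>. score_stat n (\<lambda>i. Z n i \<omega>)) \<in> borel_measurable M" "(\<lambda>\<omega>. hotelling_stat n (\<lambda>i. Z n i \<omega>)) \<in> borel_measurable M" for n
    by (intro borel_measurable_statistics Z_measurable; assumption)+
  have D_meas: "D n \<in> borel_measurable M" for n
    unfolding D_def[abs_def] using stat_meas[of n] by measurable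
  \<comment> \<open>Outside an event of small probability $n(\xi_{sc}-\xi_{hot})$ is close to $Q_n-Q_n^2$ and small compared with $n$.\<close>
  have close: "\<forall>\<^sub>F n in sequentially. \<exists>G\<in>events. prob G \<le> e \<and>
      (\<forall>\<omega>\<in>space M - G. \<bar>D n \<omega> - (q n \<omega> - (q n \<omega>)\<^sup>2)\<bar> < \<epsilon> \<and> \<bar>1 / real n * D n \<omega>\<bar> < \<epsilon>)"
    if "\<epsilon> > 0" "e > 0" for \<epsilon> e
  proof -
    define A where "A s C x = C - s *\<^sub>R outer (x - \<delta>) (x - \<delta>)" for s and C :: "real ^ 'p ^ 'p" and x
    define F where "F s q = q * (1 - (1 - s) * q) / (1 + s * q)" for s q :: real
    define P where "P = (\<lambda>(s, C) x. invertible (A s C x) \<and> 1 + s * inv_quad_form (A s C x) x \<noteq> 0 \<and>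
      \<bar>F s (inv_quad_form (A s C x) x) - (inv_quad_form \<Sigma> x - (inv_quad_form \<Sigma> x)\<^sup>2)\<bar> < \<epsilon> \<and>
      \<bar>s * F s (inv_quad_form (A s C x) x)\<bar> < \<epsilon>)"
    have "\<forall>\<^sub>F n in sequentially. \<exists>G\<in>events. prob G \<le> e \<and> (\<forall>\<omega>\<in>space M - G. P (X n \<omega>) (U n \<omega>))"
    proof (rule eventually_nbhd_with_high_probability)
      show "(\<lambda>n. prob {\<omega> \<in> space M. \<eta> \<le> dist (X n \<omega>) (0, \<Sigma>)}) \<longlonglongrightarrow> 0" if "\<eta> > 0" for \<eta>
        unfolding X_def by (rule gram_matrix_tendsto[OF that])
      show "{\<omega> \<in> space M. \<eta> \<le> dist (X n \<omega>) (0, \<Sigma>)} \<in> events" for n \<eta>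
        unfolding X_def by (rule gram_matrix_events)
      show "integrable M (\<lambda>\<omega>. (norm (U n \<omega>))\<^sup>2)" for n
        unfolding U_def by (rule normalised_sum_square_bound)
      show "expectation (\<lambda>\<omega>. (norm (U n \<omega>))\<^sup>2) \<le> 2 * (norm \<delta>)\<^sup>2 + 2 * (\<Sum>b\<in>Basis. b \<bullet> (\<Sigma> *v b))" for n
        unfolding U_def by (rule normalised_sum_square_bound)
      show "\<forall>\<^sub>F z in nhds ((0, \<Sigma>), u). P (fst z) (snd z)" for u
        unfolding P_def A_def F_def by (rule eventually_statistic_difference_close[OF \<Sigma> that(1)])
    qed (use U_meas that in auto)
    then show ?thesis using eventually_ge_at_top[of 2]
    proof eventually_elim
      case (elim n)
      then obtain G where G: "G \<in> events" "prob G \<le> e" and P: "\<And>\<omega>. \<omega> \<in> space M - G \<Longrightarrow> P (X n \<omega>) (U n \<omega>)" by blast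
      have n: "n \<ge> 2" by fact
      have "\<bar>D n \<omega> - (q n \<omega> - (q n \<omega>)\<^sup>2)\<bar> < \<epsilon> \<and> \<bar>1 / real n * D n \<omega>\<bar> < \<epsilon>" if \<omega>: "\<omega> \<in> space M - G" for \<omega>
      proof -
        let ?Z = "\<lambda>i. Z n i \<omega>"
        define B where "B = (1 / real n) *\<^sub>R (\<Sum>i\<in>{1..n}. outer (?Z i - sample_mean n ?Z) (?Z i - sample_mean n ?Z))"
        have U: "U n \<omega> = sqrt (real n) *\<^sub>R sample_mean n ?Z"
        proof -
          define r where "r = sqrt (real n)"
          have r: "r > 0" "real n = r * r" using n by (simp_all add: r_def)
          have "U n \<omega> $ j = r * (sample_mean n ?Z $ j)" for j
            using r(1) by (simp add: U_def W_def sample_mean_def sum_subtractf sum_constant_scaleR r_def[symmetric] r(2) field_simps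
                del: sum_constant)
          then show ?thesis by (simp add: vec_eq_iff r_def)
        qed
        have dev: "sample_mean n ?Z - \<delta> /\<^sub>R sqrt (real n) = (1 / sqrt (real n)) *\<^sub>R (U n \<omega> - \<delta>)"
          using n by (simp add: U scaleR_diff_right divide_inverse)
        have outer_dev: "outer (sample_mean n ?Z - \<delta> /\<^sub>R sqrt (real n)) (sample_mean n ?Z - \<delta> /\<^sub>R sqrt (real n))
            = (1 / real n) *\<^sub>R outer (U n \<omega> - \<delta>) (U n \<omega> - \<delta>)"
          unfolding dev outer_scaleR by (simp add: power_divide)
        have "B = A (1 / real n) ((1 / real n) *\<^sub>R (\<Sum>i=1..n. outer (W n i \<omega>) (W n i \<omega>))) (U n \<omega>)"
          using n unfolding B_def A_def W_def
          by (subst sum_outer_deviations[where d = "\<delta> /\<^sub>R sqrt (real n)"])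
            (simp_all add: outer_dev scaleR_diff_right)
        then have PB: "invertible B" "1 + 1 / real n * inv_quad_form B (U n \<omega>) \<noteq> 0"
          "\<bar>F (1 / real n) (inv_quad_form B (U n \<omega>)) - (q n \<omega> - (q n \<omega>)\<^sup>2)\<bar> < \<epsilon>"
          "\<bar>1 / real n * F (1 / real n) (inv_quad_form B (U n \<omega>))\<bar> < \<epsilon>"
          using P[OF \<omega>] by (simp_all add: P_def X_def q_def)
        have "D n \<omega> = F (1 / real n) (inv_quad_form B (U n \<omega>))"
          unfolding D_def F_def B_def U
          by (rule scaled_statistic_difference[OF n PB(1,2)[unfolded B_def U]])
        with PB(3,4) show ?thesis by simp
      qed
      with G show ?case by blast
    qed
  qed
  have "weak_conv_m (\<lambda>n. distr M borel (D n)) (distr (gaussian \<Sigma>) borel (\<lambda>v. inv_quad_form \<Sigma> (\<delta> + v) - (inv_quad_form \<Sigma> (\<delta> + v))\<^sup>2))"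
  proof (rule weak_conv_from_quadratic_approximation[OF prob_space_gaussian[OF \<Sigma>], of D q])
    show "D n \<in> borel_measurable M" for n by (rule D_meas)
    show "q n \<in> borel_measurable M" for n unfolding q_def[abs_def] by (intro q_meas U_meas)
    show "0 \<le> q n \<omega>" for n \<omega> by (simp add: q_def q_nonneg)
    show "(\<lambda>v. inv_quad_form \<Sigma> (\<delta> + v)) \<in> borel_measurable (gaussian \<Sigma>)" by (intro q_meas) simp
    show "0 \<le> inv_quad_form \<Sigma> (\<delta> + v)" for v by (rule q_nonneg)
    show "(\<lambda>n. \<integral>\<omega>. exp (- (real k * q n \<omega>)) \<partial>M) \<longlonglongrightarrow> (\<integral>v. exp (- (real k * inv_quad_form \<Sigma> (\<delta> + v))) \<partial>gaussian \<Sigma>)" for k :: nat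
      unfolding q_def q_eq
    proof (rule laplace_transform_quadratic_form_tendsto[OF pos_definite_matrix_inv[OF \<Sigma>] prob_space_axioms prob_space_gaussian[OF \<Sigma>]])
      show "(\<lambda>n. CLINT \<omega>|M. iexp (t \<bullet> U n \<omega>)) \<longlonglongrightarrow> (CLINT v|gaussian \<Sigma>. iexp (t \<bullet> (\<delta> + v)))" for t
        unfolding U_def by (rule characteristic_function_normalised_sum[OF \<Sigma>])
    qed (use U_meas in simp_all)
    show "\<forall>\<^sub>F n in sequentially. \<exists>G\<in>events. prob G \<le> e \<and> (\<forall>\<omega>\<in>space M - G. \<bar>D n \<omega> - (q n \<omega> - (q n \<omega>)\<^sup>2)\<bar> < \<epsilon>)"
      if "\<epsilon> > 0" "e > 0" for \<epsilon> e
      using close[OF that] by eventually_elim blast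
  qed
  moreover have "limit_K \<Sigma> \<delta> = (\<lambda>v. inv_quad_form \<Sigma> (\<delta> + v) - (inv_quad_form \<Sigma> (\<delta> + v))\<^sup>2)"
    by (intro ext limit_K_eq inv)
  moreover have "(\<lambda>n. measure M {\<omega> \<in> space M.
        \<epsilon> < \<bar>score_stat n (\<lambda>i. Z n i \<omega>) - hotelling_stat n (\<lambda>i. Z n i \<omega>)\<bar>}) \<longlonglongrightarrow> 0" if "\<epsilon> > 0" for \<epsilon>
  proof (rule tendstoI)
    fix r :: real assume "r > 0"
    then have "r / 2 > 0" by simp
    from close[OF \<open>\<epsilon> > 0\<close> this] eventually_gt_at_top[of 0]
    show "\<forall>\<^sub>F n in sequentially. dist (measure M {\<omega> \<in> space M.
        \<epsilon> < \<bar>score_stat n (\<lambda>i. Z n i \<omega>) - hotelling_stat n (\<lambda>i. Z n i \<omega>)\<bar>}) 0 < r"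
    proof eventually_elim
      case (elim n)
      then obtain G where G: "G \<in> events" "prob G \<le> r / 2" and near: "\<And>\<omega>. \<omega> \<in> space M - G \<Longrightarrow> \<bar>1 / real n * D n \<omega>\<bar> < \<epsilon>" by blast
      have "1 / real n * D n \<omega> = score_stat n (\<lambda>i. Z n i \<omega>) - hotelling_stat n (\<lambda>i. Z n i \<omega>)" for \<omega>
        using elim by (simp add: D_def)
      then have "prob {\<omega> \<in> space M. \<epsilon> < \<bar>score_stat n (\<lambda>i. Z n i \<omega>) - hotelling_stat n (\<lambda>i. Z n i \<omega>)\<bar>} \<le> prob G"
        using near by (intro finite_measure_mono G(1)) force
      then show ?case using G(2) \<open>r > 0\<close> by simp
    qed
  qed
  ultimately show ?thesis by (simp add: D_def[abs_def])
qed

end
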